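(* Let $\mathcal R$ be an ergodic p.m.p. equivalence relation on a standard probability space $(X,\mu)$, and consider the $[\mathcal R]$-action on the Polish space $\mathrm{Sub}_{\mathrm{hyp}}(\mathcal R)$ of hyperfinite subequivalence relations of $\mathcal R$. Then all $[\mathcal R]$-orbits in $\mathrm{Sub}_{\mathrm{hyp}}(\mathcal R)$ are meager (in $\mathrm{Sub}_{\mathrm{hyp}}(\mathcal R)$).
   Context: Standard probability spaces are atomless. A p.m.p. equivalence relation $\mathcal R$ on $(X,\mu)$ is the orbit equivalence relation of a measure-preserving Borel action of a countable group on $(X,\mu)$. It is ergodic if every $\mathcal R$-invariant Borel set is null or conull, and hyperfinite if on a conull set it is an increasing union of Borel equivalence relations with finite classes. Everything is considered up to null sets. Equip $\mathcal R$ with the measure $M(A)=\int_X|A_x|\,d\mu(x)$, where $A_x=\{y:(x,y)\in A\}$; $\mathrm{MAlg}(\mathcal R,M)$ is the space of Borel subsets of $\mathcal R$ modulo $M$-null sets with the topology of the metric $d_m(A,B)=m(A\triangle B)$, for $m$ any finite measure equivalent to $M$ (the topology does not depend on $m$). $\mathrm{Sub}(\mathcal R)\subseteq\mathrm{MAlg}(\mathcal R,M)$ is the (closed, hence Polish) subspace of (classes of) Borel equivalence relations on $X$ contained in $\mathcal R$, and $\mathrm{Sub}_{\mathrm{hyp}}(\mathcal R)$ is its subset of hyperfinite ones, which is closed in $\mathrm{Sub}(\mathcal R)$. The full group $[\mathcal R]$ consists of all measure-preserving automorphisms $T$ of $(X,\mu)$ (mod null sets) with $(x,T(x))\in\mathcal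 R$ for almost every $x$; it acts by $T\cdot\mathcal S=(T\times T)(\mathcal S)$. *)

theory Defs
  imports "HOL-Probability.Probability" "HOL-Algebra.Group_Action"
begin

section \<open>Standard probability spaces\<close>

definition standard_borel :: "'a measure \<Rightarrow> bool" where
  "standard_borel M \<longleftrightarrow>
     (\<exists>\<tau>. completely_metrizable_space \<tau> \<and> second_countable \<tau> \<and> topspace \<tau> = space M \<and>
          sets M = sigma_sets (space M) {U. openin \<tau> U})"

definition atomless :: "'a measure \<Rightarrow> bool" where
  "atomless M \<longleftrightarrow>
     (\<forall>A\<in>sets M. emeasure M A > 0 \<longrightarrow>
        (\<exists>B\<in>sets M. B \<subseteq> A \<and> 0 < emeasure M B \<and> emeasure M B < emeasure M A))"

definition standard_prob_space :: "'a measure \<Rightarrow> bool" where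
  "standard_prob_space M \<longleftrightarrow> prob_space M \<and> standard_borel M \<and> atomless M"


section \<open>Equivalence relations\<close>

text \<open>The countable group is taken to have its carrier inside the natural numbers; every countable
  group is isomorphic to such a group, so this is only a way of avoiding a quantifier over types.\<close>

definition pmp_equiv_rel :: "'a measure \<Rightarrow> ('a \<times> 'a) set \<Rightarrow> bool" where
  "pmp_equiv_rel M R \<longleftrightarrow>
     (\<exists>(G :: nat monoid) \<phi>. group_action G (space M) \<phi> \<and>
        (\<forall>g\<in>carrier G. \<phi> g \<in> measurable M M \<and> distr M M (\<phi> g) = M) \<and>
        R = {(x, y). x \<in> space M \<and> y \<in> Group_Action.orbit G \<phi> x})"

definition ergodic_rel :: "'a measure \<Rightarrow> ('a \<times> 'a) set \<Rightarrow> bool" where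
  "ergodic_rel M R \<longleftrightarrow>
     (\<forall>A\<in>sets M. (\<forall>(x, y)\<in>R. x \<in> A \<longleftrightarrow> y \<in> A) \<longrightarrow>
        emeasure M A = 0 \<or> emeasure M (space M - A) = 0)"

definition hyperfinite_rel :: "'a measure \<Rightarrow> ('a \<times> 'a) set \<Rightarrow> bool" where
  "hyperfinite_rel M S \<longleftrightarrow>
     (\<exists>X\<^sub>0\<in>sets M. emeasure M (space M - X\<^sub>0) = 0 \<and>
        (\<exists>F :: nat \<Rightarrow> ('a \<times> 'a) set.
           (\<forall>n. F n \<in> sets (M \<Otimes>\<^sub>M M) \<and> equiv X\<^sub>0 (F n) \<and> (\<forall>x\<in>X\<^sub>0. finite (F n `` {x})) \<and>
                F n \<subseteq> F (Suc n)) \<and>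
           S \<inter> X\<^sub>0 \<times> X\<^sub>0 = (\<Union>n. F n)))"

definition borel_subrels :: "'a measure \<Rightarrow> ('a \<times> 'a) set \<Rightarrow> ('a \<times> 'a) set set" where
  "borel_subrels M R = {S \<in> sets (M \<Otimes>\<^sub>M M). S \<subseteq> R \<and> equiv (space M) S}"


section \<open>The measure algebra of a relation\<close>

text \<open>For a p.m.p. equivalence relation the set function below is countably additive, so
  \<open>measure_of\<close> does not collapse; see \<open>emeasure_rel_measure\<close>.\<close>

definition rel_measure :: "'a measure \<Rightarrow> ('a \<times> 'a) set \<Rightarrow> ('a \<times> 'a) measure" where
  "rel_measure M R =
     measure_of R (sets (restrict_space (M \<Otimes>\<^sub>M M) R))
       (\<lambda>A. \<integral>\<^sup>+ x. emeasure (count_space UNIV) (A `` {x}) \<partial>M)"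

definition ae_eq_rel :: "'b measure \<Rightarrow> ('b set \<times> 'b set) set" where
  "ae_eq_rel N = {(A, B). A \<in> sets N \<and> B \<in> sets N \<and> sym_diff A B \<in> null_sets N}"

definition MAlg :: "'b measure \<Rightarrow> 'b set set set" where
  "MAlg N = sets N // ae_eq_rel N"

abbreviation ae_class :: "'b measure \<Rightarrow> 'b set \<Rightarrow> 'b set set" where
  "ae_class N A \<equiv> ae_eq_rel N `` {A}"

definition finite_equiv_measure :: "'b measure \<Rightarrow> 'b measure \<Rightarrow> bool" where
  "finite_equiv_measure N m \<longleftrightarrow>
     finite_measure m \<and> sets m = sets N \<and> null_sets m = null_sets N"

text \<open>The choice of representatives is immaterial on \<open>MAlg\<close>; see \<open>MAlg_dist_class\<close>.\<close>

definition MAlg_dist :: "'b measure \<Rightarrow> 'b set set \<Rightarrow> 'b set set \<Rightarrow> real" where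
  "MAlg_dist m C D = measure m (sym_diff (SOME A. A \<in> C) (SOME B. B \<in> D))"

definition MAlg_topology :: "'b measure \<Rightarrow> 'b measure \<Rightarrow> 'b set set topology" where
  "MAlg_topology N m = Metric_space.mtopology (MAlg N) (MAlg_dist m)"

definition Sub_hyp :: "'a measure \<Rightarrow> ('a \<times> 'a) set \<Rightarrow> ('a \<times> 'a) set set set" where
  "Sub_hyp M R = ae_class (rel_measure M R) ` {S \<in> borel_subrels M R. hyperfinite_rel M S}"

definition Sub_hyp_topology ::
  "'a measure \<Rightarrow> ('a \<times> 'a) set \<Rightarrow> ('a \<times> 'a) measure \<Rightarrow> ('a \<times> 'a) set set topology" where
  "Sub_hyp_topology M R m = subtopology (MAlg_topology (rel_measure M R) m) (Sub_hyp M R)"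


section \<open>The full group and its action\<close>

definition mp_automorphism :: "'a measure \<Rightarrow> ('a \<Rightarrow> 'a) \<Rightarrow> bool" where
  "mp_automorphism M T \<longleftrightarrow>
     bij_betw T (space M) (space M) \<and> T \<in> measurable M M \<and>
     inv_into (space M) T \<in> measurable M M \<and> distr M M T = M"

text \<open>The full group is represented by its everywhere defined representatives. Representatives
  that agree almost everywhere act identically on \<open>MAlg\<close>, so they produce the same orbits.\<close>

definition full_group :: "'a measure \<Rightarrow> ('a \<times> 'a) set \<Rightarrow> ('a \<Rightarrow> 'a) set" where
  "full_group M R = {T. mp_automorphism M T \<and> (AE x in M. (x, T x) \<in> R)}"

text \<open>As \<open>(x, T x) \<in> R\<close> is only required almost everywhere, the image of \<open>A \<subseteq> R\<close> under \<open>T \<times> T\<close>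
  lies in \<open>R\<close> only up to a null set; the intersection with \<open>R\<close> discards that part. The union ranges
  over equal sets; see \<open>full_group_act_class\<close>.\<close>

definition full_group_act ::
  "'a measure \<Rightarrow> ('a \<times> 'a) set \<Rightarrow> ('a \<Rightarrow> 'a) \<Rightarrow> ('a \<times> 'a) set set \<Rightarrow> ('a \<times> 'a) set set" where
  "full_group_act M R T C = (\<Union>A\<in>C. ae_class (rel_measure M R) (map_prod T T ` A \<inter> R))"

definition full_group_orbit ::
  "'a measure \<Rightarrow> ('a \<times> 'a) set \<Rightarrow> ('a \<times> 'a) set set \<Rightarrow> ('a \<times> 'a) set set set" where
  "full_group_orbit M R C = (\<lambda>T. full_group_act M R T C) ` full_group M R"


section \<open>Meager sets\<close>

definition nowhere_dense_in :: "'b topology \<Rightarrow> 'b set \<Rightarrow> bool" where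
  "nowhere_dense_in \<tau> A \<longleftrightarrow> A \<subseteq> topspace \<tau> \<and> \<tau> interior_of (\<tau> closure_of A) = {}"

definition meager_in :: "'b topology \<Rightarrow> 'b set \<Rightarrow> bool" where
  "meager_in \<tau> A \<longleftrightarrow> (\<exists>N :: nat \<Rightarrow> 'b set. (\<forall>n. nowhere_dense_in \<tau> (N n)) \<and> A = (\<Union>n. N n))"


section \<open>Well-definedness\<close>

lemma standard_borel_diagonal:
  assumes "standard_borel M"
  shows "{p \<in> space (M \<Otimes>\<^sub>M M). fst p = snd p} \<in> sets (M \<Otimes>\<^sub>M M)"
proof -
  obtain \<tau> where \<tau>: "completely_metrizable_space \<tau>" "second_countable \<tau>" "topspace \<tau> = space M"
      "sets M = sigma_sets (space M) {U. openin \<tau> U}"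
    using assms unfolding standard_borel_def by blast
  have H: "Hausdorff_space \<tau>"
    by (simp add: \<tau>(1) completely_metrizable_imp_metrizable_space metrizable_imp_Hausdorff_space)
  obtain B where B: "countable B" "\<And>V. V \<in> B \<Longrightarrow> openin \<tau> V"
      "\<And>U x. openin \<tau> U \<Longrightarrow> x \<in> U \<Longrightarrow> \<exists>V\<in>B. x \<in> V \<and> V \<subseteq> U"
    using \<tau>(2) unfolding second_countable_def by metis
  have BM: "V \<in> sets M" if "V \<in> B" for V
    using B(2)[OF that] \<tau>(4) by (auto intro: sigma_sets.Basic)
  let ?P = "{(U, V) \<in> B \<times> B. U \<inter> V = {}}"
  have cP: "countable ?P"
    by (rule countable_subset[of _ "B \<times> B"]) (use B(1) in auto)
  have "(\<Union>(U, V)\<in>?P. U \<times> V) \<in> sets (M \<Otimes>\<^sub>M M)"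
    using cP by (intro sets.countable_UN') (auto intro!: pair_measureI BM)
  moreover have "{p \<in> space (M \<Otimes>\<^sub>M M). fst p = snd p} = space (M \<Otimes>\<^sub>M M) - (\<Union>(U, V)\<in>?P. U \<times> V)"
  proof (intro equalityI subsetI)
    fix p assume "p \<in> {p \<in> space (M \<Otimes>\<^sub>M M). fst p = snd p}"
    then show "p \<in> space (M \<Otimes>\<^sub>M M) - (\<Union>(U, V)\<in>?P. U \<times> V)" by auto
  next
    fix p assume p: "p \<in> space (M \<Otimes>\<^sub>M M) - (\<Union>(U, V)\<in>?P. U \<times> V)"
    obtain x y where xy: "p = (x, y)" by (cases p)
    have sp: "x \<in> topspace \<tau>" "y \<in> topspace \<tau>"
      using p xy \<tau>(3) by (auto simp: space_pair_measure)
    have "x = y"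
    proof (rule ccontr)
      assume "x \<noteq> y"
      then obtain U V where UV: "openin \<tau> U" "openin \<tau> V" "x \<in> U" "y \<in> V" "disjnt U V"
        using H sp unfolding Hausdorff_space_def by metis
      obtain U' V' where "U' \<in> B" "x \<in> U'" "U' \<subseteq> U" "V' \<in> B" "y \<in> V'" "V' \<subseteq> V"
        using B(3)[OF UV(1,3)] B(3)[OF UV(2,4)] by blast
      moreover have "U' \<inter> V' = {}"
        using UV(5) calculation by (auto simp: disjnt_def)
      ultimately have "(x, y) \<in> (\<Union>(U, V)\<in>?P. U \<times> V)" by blast
      then show False using p xy by blast
    qed
    then show "p \<in> {p \<in> space (M \<Otimes>\<^sub>M M). fst p = snd p}" using p xy by auto
  qed
  ultimately show ?thesis by (simp only: sets.compl_sets)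
qed

lemma pmp_equiv_rel_enum:
  assumes "pmp_equiv_rel M R"
  shows "\<exists>f :: nat \<Rightarrow> 'a \<Rightarrow> 'a. (\<forall>n. f n \<in> measurable M M) \<and>
    R = {(x, y). x \<in> space M \<and> (\<exists>n. y = f n x)}"
proof -
  obtain G :: "nat monoid" and \<phi> where G: "group_action G (space M) \<phi>"
      "\<And>g. g \<in> carrier G \<Longrightarrow> \<phi> g \<in> measurable M M"
      "R = {(x, y). x \<in> space M \<and> y \<in> Group_Action.orbit G \<phi> x}"
    using assms unfolding pmp_equiv_rel_def by blast
  have 1: "\<one>\<^bsub>G\<^esub> \<in> carrier G"
    using G(1) by (simp add: group_action_def group_hom_def group.is_monoid monoid.one_closed)
  define f where "f n = \<phi> (if n \<in> carrier G then n else \<one>\<^bsub>G\<^esub>)" for n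
  have "f n \<in> measurable M M" for n using G(2) 1 by (auto simp: f_def)
  moreover have "(y \<in> Group_Action.orbit G \<phi> x) = (\<exists>n. y = f n x)" for x y
    unfolding Group_Action.orbit_def f_def using 1 by (auto split: if_splits)
  then have "R = {(x, y). x \<in> space M \<and> (\<exists>n. y = f n x)}" using G(3) by auto
  ultimately show ?thesis by blast
qed

lemma graph_measurable:
  assumes "standard_borel M" "f \<in> measurable M M"
  shows "{p \<in> space (M \<Otimes>\<^sub>M M). snd p = f (fst p)} \<in> sets (M \<Otimes>\<^sub>M M)"
proof -
  let ?D = "{p \<in> space (M \<Otimes>\<^sub>M M). fst p = snd p}"
  let ?h = "\<lambda>p. (snd p, f (fst p))"
  have h: "?h \<in> measurable (M \<Otimes>\<^sub>M M) (M \<Otimes>\<^sub>M M)"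
    by (rule measurable_Pair[OF measurable_snd measurable_compose[OF measurable_fst assms(2)]])
  have "?h -` ?D \<inter> space (M \<Otimes>\<^sub>M M) \<in> sets (M \<Otimes>\<^sub>M M)"
    by (rule measurable_sets[OF h standard_borel_diagonal[OF assms(1)]])
  moreover have "?h -` ?D \<inter> space (M \<Otimes>\<^sub>M M) = {p \<in> space (M \<Otimes>\<^sub>M M). snd p = f (fst p)}"
    by (auto simp: space_pair_measure intro: measurable_space[OF assms(2)])
  ultimately show ?thesis by simp
qed

lemma pmp_equiv_rel_sets:
  assumes "standard_borel M" "pmp_equiv_rel M R"
  shows "R \<in> sets (M \<Otimes>\<^sub>M M)"
proof -
  obtain f :: "nat \<Rightarrow> _" where "(\<forall>n. f n \<in> measurable M M) \<and> R = {(x, y). x \<in> space M \<and> (\<exists>n. y = f n x)}"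
    using pmp_equiv_rel_enum[OF assms(2)] by (rule exE)
  then have f: "\<And>n. f n \<in> measurable M M" "R = {(x, y). x \<in> space M \<and> (\<exists>n. y = f n x)}"
    by auto
  have "R = (\<Union>n. {p \<in> space (M \<Otimes>\<^sub>M M). snd p = f n (fst p)})"
    by (auto simp: f(2) space_pair_measure intro: measurable_space[OF f(1)])
  moreover have "\<dots> \<in> sets (M \<Otimes>\<^sub>M M)"
    using graph_measurable[OF assms(1) f(1)] by (intro sets.countable_UN') auto
  ultimately show ?thesis by simp
qed

lemma sets_rel_measure: "sets (rel_measure M R) = sets (restrict_space (M \<Otimes>\<^sub>M M) R)"
  if "R \<in> sets (M \<Otimes>\<^sub>M M)"
proof -
  have "space (restrict_space (M \<Otimes>\<^sub>M M) R) = R"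
    using sets.sets_into_space[OF that] by (auto simp: space_restrict_space)
  then show ?thesis
    unfolding rel_measure_def using sets.sets_measure_of_eq[of "restrict_space (M \<Otimes>\<^sub>M M) R"] by simp
qed

lemma sets_rel_measure_iff: "A \<in> sets (rel_measure M R) \<longleftrightarrow> A \<in> sets (M \<Otimes>\<^sub>M M) \<and> A \<subseteq> R"
  if "R \<in> sets (M \<Otimes>\<^sub>M M)"
  using that sets.sets_into_space[OF that]
  by (auto simp: sets_rel_measure sets_restrict_space_iff Int_absorb2)

lemma section_count:
  assumes R: "R = {(x, y). x \<in> space M \<and> (\<exists>n. y = f n x)}" and A: "A \<subseteq> R"
  shows "emeasure (count_space UNIV) (A `` {x}) =
    (\<Sum>n. indicator {x \<in> space M. (x, f n x) \<in> A \<and> (\<forall>j<n. f j x \<noteq> f n x)} x)"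
proof -
  define B where
    "B n = (if (x, f n x) \<in> A \<and> (\<forall>j<n. f j x \<noteq> f n x) then {f n x} else {})" for n
  have "(\<Union>n. B n) = A `` {x}"
  proof (intro equalityI subsetI)
    fix y assume "y \<in> A `` {x}"
    then have y: "(x, y) \<in> A" by simp
    then have "\<exists>n. y = f n x" using A R by auto
    then have "y = f (LEAST n. y = f n x) x" "\<forall>j<(LEAST n. y = f n x). f j x \<noteq> y"
      by (metis (mono_tags, lifting) LeastI) (metis not_less_Least)
    then have "y \<in> B (LEAST n. y = f n x)" using y unfolding B_def by auto
    then show "y \<in> (\<Union>n. B n)" by blast
  qed (auto simp: B_def split: if_splits)
  moreover have "disjoint_family B"
    by (auto simp: disjoint_family_on_def B_def) (metis nat_neq_iff)
  then have "emeasure (count_space UNIV) (\<Union>n. B n) = (\<Sum>n. emeasure (count_space UNIV) (B n))"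
    by (intro suminf_emeasure[symmetric]) auto
  moreover have "emeasure (count_space UNIV) (B n) =
      indicator {x \<in> space M. (x, f n x) \<in> A \<and> (\<forall>j<n. f j x \<noteq> f n x)} x" for n
    using A R by (auto simp: B_def indicator_def one_ennreal_def)
  ultimately show ?thesis by simp
qed

lemma section_count_measurable:
  assumes "standard_borel M" "pmp_equiv_rel M R" and A: "A \<in> sets (M \<Otimes>\<^sub>M M)" "A \<subseteq> R"
  shows "(\<lambda>x. emeasure (count_space UNIV) (A `` {x})) \<in> borel_measurable M"
proof -
  obtain f :: "nat \<Rightarrow> _" where "(\<forall>n. f n \<in> measurable M M) \<and> R = {(x, y). x \<in> space M \<and> (\<exists>n. y = f n x)}"
    using pmp_equiv_rel_enum[OF assms(2)] by (rule exE)
  then have f: "\<And>n. f n \<in> measurable M M" "R = {(x, y). x \<in> space M \<and> (\<exists>n. y = f n x)}"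
    by auto
  let ?D = "{p \<in> space (M \<Otimes>\<^sub>M M). fst p = snd p}"
  have "{x \<in> space M. (x, f n x) \<in> A \<and> (\<forall>j<n. f j x \<noteq> f n x)} \<in> sets M" for n
  proof -
    have "(\<lambda>x. (x, f n x)) -` A \<inter> space M \<in> sets M"
      by (rule measurable_sets[OF measurable_Pair[OF measurable_ident f(1)[of n], simplified] A(1)])
    moreover have "(\<lambda>x. (f j x, f n x)) -` ?D \<inter> space M \<in> sets M" for j
      by (rule measurable_sets[OF measurable_Pair[OF f(1)[of j] f(1)[of n]]
            standard_borel_diagonal[OF assms(1)]])
    ultimately have "((\<lambda>x. (x, f n x)) -` A \<inter> space M) -
        (\<Union>j<n. (\<lambda>x. (f j x, f n x)) -` ?D \<inter> space M) \<in> sets M"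
      by (intro sets.Diff sets.finite_UN) auto
    moreover have "((\<lambda>x. (x, f n x)) -` A \<inter> space M) -
        (\<Union>j<n. (\<lambda>x. (f j x, f n x)) -` ?D \<inter> space M) =
        {x \<in> space M. (x, f n x) \<in> A \<and> (\<forall>j<n. f j x \<noteq> f n x)}"
      by (auto simp: space_pair_measure intro: measurable_space[OF f(1)])
    ultimately show ?thesis by simp
  qed
  then show ?thesis
    unfolding section_count[OF f(2) A(2)] by (intro borel_measurable_suminf_order borel_measurable_indicator)
qed

lemma emeasure_rel_measure:
  assumes "standard_borel M" "pmp_equiv_rel M R" "A \<in> sets (rel_measure M R)"
  shows "emeasure (rel_measure M R) A = (\<integral>\<^sup>+ x. emeasure (count_space UNIV) (A `` {x}) \<partial>M)"
proof (rule emeasure_measure_of[OF rel_measure_def])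
  let ?\<mu> = "\<lambda>A. \<integral>\<^sup>+ x. emeasure (count_space UNIV) (A `` {x}) \<partial>M"
  note RS = pmp_equiv_rel_sets[OF assms(1,2)]
  show "sets (restrict_space (M \<Otimes>\<^sub>M M) R) \<subseteq> Pow R"
    by (auto simp: sets_restrict_space)
  show "positive (sets (rel_measure M R)) ?\<mu>" by (simp add: positive_def)
  show "countably_additive (sets (rel_measure M R)) ?\<mu>"
  proof (rule countably_additiveI)
    fix B :: "nat \<Rightarrow> _" assume B: "range B \<subseteq> sets (rel_measure M R)" "disjoint_family B"
    have m: "(\<lambda>x. emeasure (count_space UNIV) (B n `` {x})) \<in> borel_measurable M" for n
      using B(1) section_count_measurable[OF assms(1,2)] sets_rel_measure_iff[OF RS] by blast
    have "(\<Sum>n. emeasure (count_space UNIV) (B n `` {x})) =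
        emeasure (count_space UNIV) ((\<Union>n. B n) `` {x})" for x
    proof -
      have "disjoint_family (\<lambda>n. B n `` {x})" using B(2) by (auto simp: disjoint_family_on_def)
      then have "(\<Sum>n. emeasure (count_space UNIV) (B n `` {x})) =
          emeasure (count_space UNIV) (\<Union>n. B n `` {x})"
        by (intro suminf_emeasure) auto
      also have "(\<Union>n. B n `` {x}) = (\<Union>n. B n) `` {x}" by auto
      finally show ?thesis .
    qed
    then show "(\<Sum>n. ?\<mu> (B n)) = ?\<mu> (\<Union>n. B n)"
      using m by (simp add: nn_integral_suminf[symmetric])
  qed
qed fact

lemma null_sets_rel_measure_iff:
  assumes "standard_borel M" "pmp_equiv_rel M R"
  shows "A \<in> null_sets (rel_measure M R) \<longleftrightarrow>
    A \<in> sets (rel_measure M R) \<and> (AE x in M. A `` {x} = {})"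
proof -
  have "emeasure (rel_measure M R) A = 0 \<longleftrightarrow> (AE x in M. A `` {x} = {})"
    if A: "A \<in> sets (rel_measure M R)"
  proof -
    have "A \<in> sets (M \<Otimes>\<^sub>M M)" "A \<subseteq> R"
      using A sets_rel_measure_iff[OF pmp_equiv_rel_sets[OF assms]] by auto
    then show ?thesis
      using section_count_measurable[OF assms]
      by (simp add: emeasure_rel_measure[OF assms A] nn_integral_0_iff_AE emeasure_count_space_eq_0)
  qed
  then show ?thesis by (auto simp: null_sets_def)
qed

lemma finite_equiv_measure_exists:
  assumes "prob_space M" "standard_borel M" "pmp_equiv_rel M R"
  shows "\<exists>m. finite_equiv_measure (rel_measure M R) m"
proof -
  interpret prob_space M by fact
  let ?N = "rel_measure M R"
  note RS = pmp_equiv_rel_sets[OF assms(2,3)]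
  obtain f :: "nat \<Rightarrow> _" where "(\<forall>n. f n \<in> measurable M M) \<and> R = {(x, y). x \<in> space M \<and> (\<exists>n. y = f n x)}"
    using pmp_equiv_rel_enum[OF assms(3)] by (rule exE)
  then have f: "\<And>n. f n \<in> measurable M M" "R = {(x, y). x \<in> space M \<and> (\<exists>n. y = f n x)}"
    by auto
  define Gr where "Gr n = {p \<in> space (M \<Otimes>\<^sub>M M). snd p = f n (fst p)}" for n
  have GR: "Gr n \<subseteq> R" for n by (auto simp: Gr_def f(2) space_pair_measure)
  have GS: "Gr n \<in> sets ?N" for n
    using sets_rel_measure_iff[OF RS] GR graph_measurable[OF assms(2) f(1)] by (auto simp: Gr_def)
  have sp: "space ?N = R"
    unfolding rel_measure_def by (rule space_measure_of) (auto simp: sets_restrict_space)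
  have cov: "(\<Union>n. Gr n) = space ?N"
    unfolding sp by (auto simp: Gr_def f(2) space_pair_measure intro: measurable_space[OF f(1)])
  have fin: "emeasure ?N (Gr n) \<noteq> \<infinity>" for n
  proof -
    have "emeasure ?N (Gr n) \<le> (\<integral>\<^sup>+ x. 1 \<partial>M)"
      unfolding emeasure_rel_measure[OF assms(2,3) GS]
    proof (rule nn_integral_mono)
      fix x assume "x \<in> space M"
      have "emeasure (count_space UNIV) (Gr n `` {x}) \<le> emeasure (count_space UNIV) {f n x}"
        by (rule emeasure_mono) (auto simp: Gr_def)
      then show "emeasure (count_space UNIV) (Gr n `` {x}) \<le> 1" by (simp add: one_ennreal_def)
    qed
    then show ?thesis by (auto simp: emeasure_space_1 top_unique)
  qed
  interpret N: sigma_finite_measure ?N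

  proof
    show "\<exists>A. countable A \<and> A \<subseteq> sets ?N \<and> \<Union> A = space ?N \<and> (\<forall>a\<in>A. emeasure ?N a \<noteq> \<infinity>)"
      using GS cov fin by (intro exI[of _ "range Gr"]) auto
  qed
  obtain h where h: "h \<in> borel_measurable ?N" "integral\<^sup>N ?N h \<noteq> \<infinity>"
      "\<And>x. x \<in> space ?N \<Longrightarrow> 0 < h x"
    using N.Ex_finite_integrable_function by blast
  have "finite_measure (density ?N h)"
    using h(1,2) by (intro finite_measureI) (simp add: emeasure_density cong: nn_integral_cong)
  moreover have "A \<in> null_sets (density ?N h) \<longleftrightarrow> A \<in> null_sets ?N" for A
  proof -
    have "(AE x in ?N. x \<in> A \<longrightarrow> h x = 0) \<longleftrightarrow> (AE x in ?N. x \<notin> A)"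
      by (rule AE_cong) (use h(3) in force)
    then have "A \<in> null_sets (density ?N h) \<longleftrightarrow> A \<in> sets ?N \<and> (AE x in ?N. x \<notin> A)"
      by (simp add: null_sets_density_iff[OF h(1)])
    then show ?thesis using AE_iff_null_sets[of A ?N] null_setsD2[of A ?N] by blast
  qed
  then have "null_sets (density ?N h) = null_sets ?N" by blast
  ultimately have "finite_equiv_measure ?N (density ?N h)"
    unfolding finite_equiv_measure_def by (intro conjI sets_density)
  then show ?thesis by (rule exI)
qed

lemma equiv_ae_eq_rel: "equiv (sets N) (ae_eq_rel N)"
proof (rule equivI)
  show "trans (ae_eq_rel N)"
  proof (rule transI)
    fix A B C assume "(A, B) \<in> ae_eq_rel N" "(B, C) \<in> ae_eq_rel N"
    then have *: "A \<in> sets N" "C \<in> sets N" "sym_diff A B \<union> sym_diff B C \<in> null_sets N"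
      by (auto simp: ae_eq_rel_def)
    have "sym_diff A C \<in> null_sets N"
      by (rule null_sets_subset[OF *(3)]) (use * in auto)
    then show "(A, C) \<in> ae_eq_rel N" using * by (simp add: ae_eq_rel_def)
  qed
qed (auto simp: ae_eq_rel_def refl_on_def sym_def Un_commute)

lemma MAlg_dist_class:
  assumes m: "finite_equiv_measure N m" and "A \<in> sets N" "B \<in> sets N"
  shows "MAlg_dist m (ae_class N A) (ae_class N B) = measure m (sym_diff A B)"
proof -
  define A' where "A' = (SOME A'. A' \<in> ae_class N A)"
  define B' where "B' = (SOME B'. B' \<in> ae_class N B)"
  have "A \<in> ae_class N A" "B \<in> ae_class N B"
    using assms by (auto simp: ae_eq_rel_def)
  then have "A' \<in> ae_class N A" "B' \<in> ae_class N B"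
    unfolding A'_def B'_def by (auto intro: someI)
  then have *: "A' \<in> sets m" "B' \<in> sets m" "A \<in> sets m" "B \<in> sets m"
      "sym_diff A A' \<in> null_sets m" "sym_diff B B' \<in> null_sets m"
    using m by (auto simp: ae_eq_rel_def finite_equiv_measure_def)
  let ?Z = "sym_diff A A' \<union> sym_diff B B'"
  have Z: "?Z \<in> null_sets m" using *(5,6) by blast
  have "measure m (sym_diff A' B') = measure m (sym_diff A' B' \<union> ?Z)"
    using * Z by (intro measure_Un_null_set[symmetric]) auto
  also have "sym_diff A' B' \<union> ?Z = sym_diff A B \<union> ?Z" by auto
  also have "measure m \<dots> = measure m (sym_diff A B)"
    using * Z by (intro measure_Un_null_set) auto
  finally show ?thesis unfolding MAlg_dist_def A'_def B'_def .
qed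

lemma Metric_space_MAlg:
  assumes m: "finite_equiv_measure N m"
  shows "Metric_space (MAlg N) (MAlg_dist m)"
proof -
  interpret finite_measure m using m by (simp add: finite_equiv_measure_def)
  have sets: "sets m = sets N" and null: "null_sets m = null_sets N"
    using m by (auto simp: finite_equiv_measure_def)
  note d = MAlg_dist_class[OF m]
  have cls: "\<exists>A\<in>sets N. C = ae_class N A" if "C \<in> MAlg N" for C
    using that unfolding MAlg_def by (auto elim!: quotientE)
  show ?thesis
  proof (rule Metric_space.intro)
    show "0 \<le> MAlg_dist m C D" for C D
      unfolding MAlg_dist_def by (rule measure_nonneg)
    show "MAlg_dist m C D = MAlg_dist m D C" for C D
      unfolding MAlg_dist_def by (subst Un_commute) (rule refl)
  next
    fix C D assume C: "C \<in> MAlg N" and D: "D \<in> MAlg N"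
    obtain A where A: "A \<in> sets N" "C = ae_class N A" using cls[OF C] by (rule bexE)
    obtain B where B: "B \<in> sets N" "D = ae_class N B" using cls[OF D] by (rule bexE)
    note AB = A(1) B(1) and CD = A(2) B(2)
    have "MAlg_dist m C D = measure m (sym_diff A B)"
      unfolding CD by (rule d[OF AB])
    also have "\<dots> = 0 \<longleftrightarrow> sym_diff A B \<in> null_sets m"
      using AB sets by (simp add: null_sets_def emeasure_eq_measure sets.Un sets.Diff)
    finally have "MAlg_dist m C D = 0 \<longleftrightarrow> sym_diff A B \<in> null_sets N"
      unfolding null .
    also have "\<dots> \<longleftrightarrow> (A, B) \<in> ae_eq_rel N" using AB by (simp add: ae_eq_rel_def)
    also have "\<dots> \<longleftrightarrow> C = D" unfolding CD using eq_equiv_class_iff[OF equiv_ae_eq_rel AB] by simp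
    finally show "MAlg_dist m C D = 0 \<longleftrightarrow> C = D" .
  next
    fix C D E assume C: "C \<in> MAlg N" and D: "D \<in> MAlg N" and E: "E \<in> MAlg N"
    obtain A where 1: "A \<in> sets N" "C = ae_class N A" using cls[OF C] by (rule bexE)
    obtain B where 2: "B \<in> sets N" "D = ae_class N B" using cls[OF D] by (rule bexE)
    obtain F where 3: "F \<in> sets N" "E = ae_class N F" using cls[OF E] by (rule bexE)
    note A = 1(1) 2(1) 3(1) and CDE = 1(2) 2(2) 3(2)
    have "measure m (sym_diff A F) \<le> measure m (sym_diff A B \<union> sym_diff B F)"
      using A sets by (intro finite_measure_mono) auto
    also have "\<dots> \<le> measure m (sym_diff A B) + measure m (sym_diff B F)"
      using A sets by (intro measure_Un_le) auto
    finally show "MAlg_dist m C E \<le> MAlg_dist m C D + MAlg_dist m D E"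
      unfolding CDE d[OF A(1,2)] d[OF A(2,3)] d[OF A(1,3)] .
  qed
qed

lemma full_group_act_class:
  assumes "standard_borel M" "pmp_equiv_rel M R" and T: "mp_automorphism M T"
    and A: "A \<in> sets (rel_measure M R)"
  shows "full_group_act M R T (ae_class (rel_measure M R) A) =
    ae_class (rel_measure M R) (map_prod T T ` A \<inter> R)"
proof -
  let ?N = "rel_measure M R"
  let ?T' = "inv_into (space M) T"
  note RS = pmp_equiv_rel_sets[OF assms(1,2)]
  note S = sets_rel_measure_iff[OF RS]
  have T': "?T' \<in> measurable M M" "T \<in> measurable M M" "bij_betw T (space M) (space M)"
      "distr M M T = M"
    using T by (auto simp: mp_automorphism_def)
  have TT': "T (?T' y) = y" "?T' y \<in> space M" if "y \<in> space M" for y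
    using that T'(3) by (auto simp: bij_betw_def f_inv_into_f inv_into_into)
  have T'T: "?T' (T x) = x" if "x \<in> space M" for x
    using that T'(3) by (auto simp: bij_betw_def)
  have Rsp: "B \<subseteq> space M \<times> space M" if "B \<in> sets (M \<Otimes>\<^sub>M M)" for B
    using sets.sets_into_space[OF that] by (simp add: space_pair_measure)
  have image: "map_prod T T ` B = map_prod ?T' ?T' -` B \<inter> space (M \<Otimes>\<^sub>M M)"
    if "B \<in> sets (M \<Otimes>\<^sub>M M)" for B
  proof (intro equalityI subsetI)
    fix p assume "p \<in> map_prod T T ` B"
    then show "p \<in> map_prod ?T' ?T' -` B \<inter> space (M \<Otimes>\<^sub>M M)"
      using Rsp[OF that] T'T by (auto simp: space_pair_measure intro: measurable_space[OF T'(2)])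
  next
    fix p assume p: "p \<in> map_prod ?T' ?T' -` B \<inter> space (M \<Otimes>\<^sub>M M)"
    then have "p = map_prod T T (map_prod ?T' ?T' p)"
      using TT' by (auto simp: space_pair_measure)
    then show "p \<in> map_prod T T ` B" using p by blast
  qed
  have imS: "map_prod T T ` B \<inter> R \<in> sets ?N" if "B \<in> sets ?N" for B
  proof -
    have "map_prod ?T' ?T' \<in> measurable (M \<Otimes>\<^sub>M M) (M \<Otimes>\<^sub>M M)"
      unfolding map_prod_def case_prod_beta using T'(1) by measurable
    then have "map_prod T T ` B \<in> sets (M \<Otimes>\<^sub>M M)"
      using that S image by (auto intro: measurable_sets)
    then show ?thesis using S RS by auto
  qed
  have null: "map_prod T T ` Z \<inter> R \<in> null_sets ?N" if Z: "Z \<in> null_sets ?N" for Z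
  proof -
    have ZS: "Z \<in> sets (M \<Otimes>\<^sub>M M)" "Z \<subseteq> R" and Z0: "AE x in M. Z `` {x} = {}"
      using Z null_sets_rel_measure_iff[OF assms(1,2)] S by auto
    have "{x \<in> space M. Z `` {x} = {}} =
        (\<lambda>x. emeasure (count_space UNIV) (Z `` {x})) -` {0} \<inter> space M"
      by (auto simp: emeasure_count_space_eq_0)
    also have "\<dots> \<in> sets M"
      by (intro measurable_sets[OF section_count_measurable[OF assms(1,2) ZS]]) simp
    finally have "?T' -` {x \<in> space M. Z `` {x} = {}} \<inter> space M \<in> sets M"
      by (rule measurable_sets[OF T'(1)])
    also have "?T' -` {x \<in> space M. Z `` {x} = {}} \<inter> space M =
        {y \<in> space M. Z `` {?T' y} = {}}" using TT'(2) by auto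
    finally have m: "{y \<in> space M. Z `` {?T' y} = {}} \<in> sets M" .
    have "AE x in M. Z `` {?T' (T x)} = {}" using Z0 T'T by (auto elim!: AE_mp intro!: AE_I2)
    then have "AE y in distr M M T. Z `` {?T' y} = {}"
      using AE_distr_iff[OF T'(2) m] by simp
    then have "AE y in M. Z `` {?T' y} = {}" by (simp only: T'(4))
    then have "AE y in M. (map_prod T T ` Z \<inter> R) `` {y} = {}"
    proof (rule AE_mp, intro AE_I2 impI)
      fix y assume "y \<in> space M" and y: "Z `` {?T' y} = {}"
      show "(map_prod T T ` Z \<inter> R) `` {y} = {}" using y by (auto simp: image[OF ZS(1)])
    qed
    then show ?thesis using imS Z null_sets_rel_measure_iff[OF assms(1,2)] by blast
  qed
  have eq: "ae_class ?N (map_prod T T ` B \<inter> R) = ae_class ?N (map_prod T T ` A \<inter> R)"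
    if "B \<in> ae_class ?N A" for B
  proof -
    have B: "B \<in> sets ?N" "sym_diff A B \<in> null_sets ?N" using that by (auto simp: ae_eq_rel_def)
    have "sym_diff (map_prod T T ` A \<inter> R) (map_prod T T ` B \<inter> R) \<in> null_sets ?N"
      by (rule null_sets_subset[OF null[OF B(2)]]) (use imS[OF A] imS[OF B(1)] in auto)
    then have "(map_prod T T ` A \<inter> R, map_prod T T ` B \<inter> R) \<in> ae_eq_rel ?N"
      using imS[OF A] imS[OF B(1)] by (simp add: ae_eq_rel_def)
    then show ?thesis by (rule equiv_class_eq[OF equiv_ae_eq_rel, symmetric])
  qed
  have "A \<in> ae_class ?N A" using A by (auto simp: ae_eq_rel_def)
  then have ne: "ae_class ?N A \<noteq> {}" by blast
  have "full_group_act M R T (ae_class ?N A) =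
      (\<Union>B\<in>ae_class ?N A. ae_class ?N (map_prod T T ` A \<inter> R))"
    unfolding full_group_act_def by (rule SUP_cong[OF refl eq])
  also have "\<dots> = ae_class ?N (map_prod T T ` A \<inter> R)"
    unfolding UN_constant using ne by (simp only: if_False)
  finally show ?thesis .
qed

end

theory Submission
  imports Defs
begin

text \<open>The full group is separable for the uniform metric \<open>\<mu> {x. S x \<noteq> T x}\<close>, so it splits into
  countably many pieces of uniform diameter less than \<open>1/4\<close>, and an orbit splits accordingly. Two
  members of one piece of the orbit coincide on \<open>A \<times> A\<close> for some \<open>A\<close> with \<open>\<mu> A > 3/4\<close>. On the
  other hand, every open set contains a relation \<open>F\<close> with finite classes, and near \<open>F\<close> there is a
  relation \<open>S'\<close> that pairs up almost all classes of \<open>F\<close> along far away partners, so that some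
  injective \<open>\<theta>\<close> satisfies \<open>(x, \<theta> x) \<in> S' - F\<close> almost everywhere. Relations close enough to \<open>F\<close> and
  to \<open>S'\<close> still disagree at \<open>(x, \<theta> x)\<close> for more than half of the \<open>x\<close>, which prevents them from
  coinciding on such an \<open>A\<close>. Hence no piece is dense in an open set.\<close>

section \<open>Transversals and matchings of countable equivalence relations\<close>

text \<open>Hyperfiniteness enters through the density of relations with finite classes. Such a
  relation leaves room to be enlarged inside \<open>R\<close>, because ergodicity and atomlessness
  make every measurable set null that meets each class of \<open>R\<close> in finitely many points.
  Enlarging by distant partners is nearly invisible to the metric: the graphs of finitely many of
  the maps \<open>f j\<close> carry all but a small part of the finite measure \<open>m\<close> on
  \<open>R\<close>. To tell whole neighbourhoods of \<open>F\<close> and \<open>S'\<close> apart,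
  \<open>\<theta>\<close> must pull small sets back to small sets. This is why partner classes need
  equal shape: points with equal labels correspond, and \<open>\<theta>\<close> becomes an injection
  along \<open>R\<close>. The number 1/4 counts exceptional sets. A point x can fail because x or
  \<open>\<theta> x\<close> lies outside \<open>A\<close>, or because one of the two nearby
  relations differs from \<open>F\<close> or from \<open>S'\<close> at
  \<open>(x, \<theta> x)\<close>. Four sets of measure below 1/4 and a null set cannot cover a
  probability space.\<close>

text \<open>The group and the topology survive only as countable data: maps \<open>f n\<close>, with
  \<open>\<iota> n\<close> the index of an inverse, and sets \<open>B n\<close> that separate points
  and generate the sigma-algebra. Borel constructions become case distinctions over indices;
  repetitions among the \<open>f n\<close> are allowed.\<close>

locale countable_pmp = prob_space M for M :: "'a measure" +
  fixes R :: "('a \<times> 'a) set" and f :: "nat \<Rightarrow> 'a \<Rightarrow> 'a" and \<iota> :: "nat \<Rightarrow> nat" and B :: "nat \<Rightarrow> 'a set"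
  assumes diagonal: "{p \<in> space (M \<Otimes>\<^sub>M M). fst p = snd p} \<in> sets (M \<Otimes>\<^sub>M M)"
    and f_meas[measurable]: "f n \<in> measurable M M"
    and f_distr: "distr M M (f n) = M"
    and inv_f: "x \<in> space M \<Longrightarrow> f (\<iota> n) (f n x) = x"
    and f_inv: "x \<in> space M \<Longrightarrow> f n (f (\<iota> n) x) = x"
    and R_eq: "R = {(x, y). x \<in> space M \<and> (\<exists>n. y = f n x)}"
    and R_equiv: "equiv (space M) R"
    and B_sets[measurable]: "B n \<in> sets M"
    and B_sep: "x \<in> space M \<Longrightarrow> y \<in> space M \<Longrightarrow> x \<noteq> y \<Longrightarrow> \<exists>n. x \<in> B n \<and> y \<notin> B n"
    and B_gen: "sets M = sigma_sets (space M) (range B)"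
begin

section \<open>Measurability along \<open>R\<close> and invariance of the measure\<close>

lemma f_space[simp]: "x \<in> space M \<Longrightarrow> f n x \<in> space M"
  by (rule measurable_space[OF f_meas])

text \<open>Equality of points need not be measurable in an abstract measurable space. The
  measurable diagonal is what makes every later condition such as \<open>\<pi> x = x\<close>
  measurable.\<close>

lemma pred_eq[measurable (raw)]:
  assumes [measurable]: "u \<in> measurable N M" "v \<in> measurable N M"
  shows "Measurable.pred N (\<lambda>x. u x = v x)"
proof -
  note [measurable] = diagonal
  have "Measurable.pred N (\<lambda>x. (u x, v x) \<in> {p \<in> space (M \<Otimes>\<^sub>M M). fst p = snd p})"
    by measurable
  then show ?thesis
    by (rule measurable_cong[THEN iffD1, rotated])
      (auto simp: space_pair_measure intro: measurable_space[OF assms(1)] measurable_space[OF assms(2)])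
qed

lemma R_D: "(x, y) \<in> R \<Longrightarrow> x \<in> space M \<and> y \<in> space M"
  using equiv_type[OF R_equiv] by auto

lemma R_f[simp]: "x \<in> space M \<Longrightarrow> (x, f n x) \<in> R"
  by (auto simp: R_eq)

lemma R_E: "(x, y) \<in> R \<Longrightarrow> \<exists>n. y = f n x"
  by (auto simp: R_eq)

lemma R_sym: "(x, y) \<in> R \<Longrightarrow> (y, x) \<in> R"
  using R_equiv unfolding equiv_def by (blast dest: symD)

lemma R_trans: "(x, y) \<in> R \<Longrightarrow> (y, z) \<in> R \<Longrightarrow> (x, z) \<in> R"
  using R_equiv unfolding equiv_def by (blast dest: transD)

lemma R_sets[measurable]: "R \<in> sets (M \<Otimes>\<^sub>M M)"
proof -
  have "R = {p \<in> space (M \<Otimes>\<^sub>M M). \<exists>n. snd p = f n (fst p)}"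
    by (auto simp: R_eq space_pair_measure)
  also have "\<dots> \<in> sets (M \<Otimes>\<^sub>M M)" by measurable
  finally show ?thesis .
qed

lemma emeasure_f_vimage: "A \<in> sets M \<Longrightarrow> emeasure M (f n -` A \<inter> space M) = emeasure M A"
  using emeasure_distr[OF f_meas[of n], of A] f_distr[of n] by simp

lemma f_image:
  assumes "A \<in> sets M"
  shows "f n ` A = f (\<iota> n) -` A \<inter> space M"
proof (intro equalityI subsetI)
  fix y assume "y \<in> f (\<iota> n) -` A \<inter> space M"
  then have "f (\<iota> n) y \<in> A" "y = f n (f (\<iota> n) y)" using f_inv by auto
  then show "y \<in> f n ` A" by blast
qed (use sets.sets_into_space[OF assms] inv_f in auto)

lemma f_image_sets[measurable]: "A \<in> sets M \<Longrightarrow> f n ` A \<in> sets M"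
  by (simp add: f_image measurable_sets[OF f_meas])

lemma emeasure_f_image: "A \<in> sets M \<Longrightarrow> emeasure M (f n ` A) = emeasure M A"
  by (simp add: f_image emeasure_f_vimage)

text \<open>A partial map whose graph lies in \<open>R\<close> is pieced together from the \<open>f n\<close>; this is where the
  invariance of the measure under the group turns into invariance along \<open>R\<close>.\<close>

lemma emeasure_inj_le:
  assumes P[measurable]: "P \<in> sets M" and A[measurable]: "A \<in> sets M"
    and \<theta>[measurable]: "\<theta> \<in> measurable M M"
    and inj: "inj_on \<theta> P" and R: "\<And>x. x \<in> P \<Longrightarrow> (x, \<theta> x) \<in> R"
  shows "emeasure M {x \<in> P. \<theta> x \<in> A} \<le> emeasure M A"
proof -
  define Q where "Q n = {x \<in> space M. x \<in> P \<and> \<theta> x \<in> A \<and> \<theta> x = f n x \<and> (\<forall>j<n. \<theta> x \<noteq> f j x)}" for n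
  have Qm[measurable]: "Q n \<in> sets M" for n
    unfolding Q_def by measurable
  have Q\<theta>: "f n ` Q n = \<theta> ` Q n" for n
    by (rule image_cong) (auto simp: Q_def)
  have disj: "disjoint_family Q"
    unfolding disjoint_family_on_def Q_def by (auto, metis linorder_neqE_nat)
  have eq: "{x \<in> P. \<theta> x \<in> A} = (\<Union>n. Q n)"
  proof (intro equalityI subsetI)
    fix x assume x: "x \<in> {x \<in> P. \<theta> x \<in> A}"
    then have "\<exists>n. \<theta> x = f n x" using R R_E by auto
    then have "x \<in> Q (LEAST n. \<theta> x = f n x)"
      using x sets.sets_into_space[OF P] by (auto simp: Q_def dest: not_less_Least intro: LeastI_ex)
    then show "x \<in> (\<Union>n. Q n)" by blast
  qed (auto simp: Q_def)
  have "emeasure M {x \<in> P. \<theta> x \<in> A} = (\<Sum>n. emeasure M (Q n))"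
    unfolding eq by (rule suminf_emeasure[symmetric]) (use disj in auto)
  also have "\<dots> = (\<Sum>n. emeasure M (f n ` Q n))"
    by (simp add: emeasure_f_image)
  also have "\<dots> = emeasure M (\<Union>n. f n ` Q n)"
  proof (rule suminf_emeasure)
    show "disjoint_family (\<lambda>n. f n ` Q n)"
      unfolding Q\<theta> disjoint_family_on_def
    proof (intro ballI impI)
      fix i j :: nat assume "i \<noteq> j"
      then have "Q i \<inter> Q j = {}" using disj by (auto simp: disjoint_family_on_def)
      moreover have "Q i \<subseteq> P" "Q j \<subseteq> P" by (auto simp: Q_def)
      ultimately show "\<theta> ` Q i \<inter> \<theta> ` Q j = {}" using inj by (simp add: inj_on_image_Int[symmetric])
    qed
  qed auto
  also have "\<dots> \<le> emeasure M A"
    by (rule emeasure_mono) (auto simp: Q\<theta> Q_def)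
  finally show ?thesis .
qed

section \<open>Selection by least indices, and transversals\<close>

text \<open>Choosing the least suitable index replaces a measurable selection theorem. The points
  without a suitable index share one default index, so they form a single measurable piece.\<close>

lemma measurable_least_f[measurable (raw)]:
  assumes [measurable]: "\<And>n. Measurable.pred M (Q n)"
  shows "(\<lambda>x. f (LEAST n. Q n x) x) \<in> measurable M M"
  by (rule measurable_compose_countable[of "\<lambda>n. f n"]) measurable

text \<open>At stage j each class keeps its surviving points in \<open>B j\<close> if there are any,
  and all survivors otherwise. So \<open>D\<close> picks the point whose sequence of memberships in
  \<open>B 0\<close>, \<open>B 1\<close>, ... is lexicographically greatest. Finiteness of the class
  keeps the intersection nonempty; separation of points leaves no second point.\<close>

lemma transversal:
  assumes S[measurable]: "S \<in> sets (M \<Otimes>\<^sub>M M)" and eq: "equiv (space M) S" and SR: "S \<subseteq> R"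
    and fin: "\<And>x. x \<in> space M \<Longrightarrow> finite (S `` {x})"
  shows "\<exists>\<pi>\<in>measurable M M. (\<forall>x\<in>space M. (x, \<pi> x) \<in> S) \<and> (\<forall>x y. (x, y) \<in> S \<longrightarrow> \<pi> x = \<pi> y)"
proof -
  have Sr: "x \<in> space M \<Longrightarrow> (x, x) \<in> S" for x
    using eq by (auto simp: equiv_def refl_on_def)
  have Ss: "(x, y) \<in> S \<Longrightarrow> (y, x) \<in> S" for x y using eq unfolding equiv_def by (blast dest: symD)
  have St: "(x, y) \<in> S \<Longrightarrow> (y, z) \<in> S \<Longrightarrow> (x, z) \<in> S" for x y z
    using eq unfolding equiv_def by (blast dest: transD)
  define K where "K = rec_nat (space M)
    (\<lambda>j A. {x \<in> space M. x \<in> A \<and> (x \<in> B j \<or> (\<forall>n. (x, f n x) \<in> S \<longrightarrow> f n x \<notin> A \<inter> B j))})"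
  have K0: "K 0 = space M" by (simp add: K_def)
  have K_Suc: "K (Suc j) = {x \<in> space M. x \<in> K j \<and>
      (x \<in> B j \<or> (\<forall>n. (x, f n x) \<in> S \<longrightarrow> f n x \<notin> K j \<inter> B j))}" for j
    by (simp add: K_def)
  have Kanti: "i \<le> j \<Longrightarrow> K j \<subseteq> K i" for i j
    by (induction rule: dec_induct) (auto simp: K_Suc)
  have Km[measurable]: "K j \<in> sets M" for j
  proof (induction j)
    case (Suc j)
    note [measurable] = Suc
    show ?case unfolding K_Suc by measurable
  qed (simp add: K0)
  have step: "\<exists>z. (x, z) \<in> S \<and> z \<in> K j" if "x \<in> space M" for x j
  proof (induction j)
    case 0
    then show ?case using Sr that by (auto simp: K0)
  next
    case (Suc j)
    then obtain z where z: "(x, z) \<in> S" "z \<in> K j" by blast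
    show ?case
    proof (cases "z \<in> K (Suc j)")
      case False
      then obtain n where "(z, f n z) \<in> S" "f n z \<in> K j \<inter> B j"
        using z SR R_D by (auto simp: K_Suc)
      then show ?thesis using z(1) St SR R_D by (intro exI[of _ "f n z"]) (auto simp: K_Suc)
    qed (use z in blast)
  qed
  define D where "D = (\<Inter>j. K j)"
  have Dm[measurable]: "D \<in> sets M" unfolding D_def by measurable
  have ex: "\<exists>n. (x, f n x) \<in> S \<and> f n x \<in> D" if x: "x \<in> space M" for x
  proof -
    define c where "c j = S `` {x} \<inter> K j" for j
    have cfin: "finite (c j)" and cne: "c j \<noteq> {}" for j
      using fin[OF x] step[OF x, of j] by (auto simp: c_def)
    have canti: "i \<le> j \<Longrightarrow> c j \<subseteq> c i" for i j using Kanti[of i j] by (auto simp: c_def)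
    obtain j0 where j0: "\<And>j. card (c j0) \<le> card (c j)"
      using ex_has_least_nat[of "\<lambda>_. True" 0 "\<lambda>j. card (c j)"] by blast
    have "c j0 \<subseteq> c j" for j
    proof (cases "j \<le> j0")
      case False
      then have "c j = c j0" by (intro card_seteq cfin canti j0) simp
      then show ?thesis by simp
    qed (rule canti)
    moreover obtain y where y: "y \<in> c j0" using cne by blast
    ultimately have "y \<in> D" "(x, y) \<in> S" by (auto simp: D_def c_def)
    moreover obtain n where "y = f n x" using \<open>(x, y) \<in> S\<close> SR R_E by blast
    ultimately show ?thesis by blast
  qed
  have uniq: "y = z" if D: "y \<in> D" "z \<in> D" and yz: "(y, z) \<in> S" for y z
  proof (rule ccontr)
    assume "y \<noteq> z"
    moreover have sp: "y \<in> space M" "z \<in> space M" using yz SR R_D by auto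
    ultimately obtain j where j: "y \<in> B j" "z \<notin> B j" using B_sep by metis
    have "z \<in> K (Suc j)" "y \<in> K j" using D by (auto simp: D_def)
    moreover obtain n where "y = f n z" using Ss[OF yz] SR R_E by blast
    ultimately show False using j Ss[OF yz] by (auto simp: K_Suc)
  qed
  define \<pi> where "\<pi> x = f (LEAST n. (x, f n x) \<in> S \<and> f n x \<in> D) x" for x
  have \<pi>: "(x, \<pi> x) \<in> S" "\<pi> x \<in> D" if "x \<in> space M" for x
    using LeastI_ex[OF ex[OF that]] by (auto simp: \<pi>_def)
  have "\<pi> \<in> measurable M M" unfolding \<pi>_def by measurable
  moreover have "\<forall>x\<in>space M. (x, \<pi> x) \<in> S" using \<pi> by simp
  moreover have "\<pi> x = \<pi> y" if xy: "(x, y) \<in> S" for x y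
  proof (rule uniq)
    have "x \<in> space M" "y \<in> space M" using xy SR R_D by auto
    then show "\<pi> x \<in> D" "\<pi> y \<in> D" "(\<pi> x, \<pi> y) \<in> S" using \<pi> xy Ss St by metis+
  qed
  then have "\<forall>x y. (x, y) \<in> S \<longrightarrow> \<pi> x = \<pi> y" by simp
  ultimately show ?thesis by (intro bexI[of _ \<pi>] conjI)
qed

section \<open>Null sets, saturations and ergodicity\<close>

lemma null_saturation:
  assumes "A \<in> null_sets M"
  shows "{x \<in> space M. \<exists>n. f n x \<in> A} \<in> null_sets M"
proof -
  have "(\<Union>n. f n -` A \<inter> space M) \<in> null_sets M"
    using assms by (intro null_sets_UN) (auto simp: null_sets_def emeasure_f_vimage measurable_sets[OF f_meas])
  moreover have "{x \<in> space M. \<exists>n. f n x \<in> A} = (\<Union>n. f n -` A \<inter> space M)" by auto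
  ultimately show ?thesis by simp
qed

text \<open>Otherwise a transversal \<open>D\<close> of \<open>R\<close> restricted to
  \<open>L\<close> has positive measure, because its saturation covers \<open>L\<close>.
  Atomlessness splits \<open>D\<close> into two parts of positive measure. Their saturations are
  invariant, and disjoint since \<open>D\<close> meets a class of \<open>R\<close> at most once,
  whereas ergodicity makes both conull.\<close>

lemma finite_classes_null:
  assumes erg: "ergodic_rel M R" and atm: "atomless M"
    and L[measurable]: "L \<in> sets M" and fin: "\<And>x. x \<in> L \<Longrightarrow> finite (R `` {x} \<inter> L)"
  shows "emeasure M L = 0"
proof (rule ccontr)
  assume pos: "emeasure M L \<noteq> 0"
  have Lsp: "L \<subseteq> space M" using sets.sets_into_space[OF L] .
  \<comment> \<open>Off \<open>L\<close> only the diagonal is kept, so that this is an equivalence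
    relation with finite classes on the whole space and has a transversal.\<close>
  define S where "S = {p \<in> space (M \<Otimes>\<^sub>M M). fst p = snd p \<or> p \<in> R \<and> fst p \<in> L \<and> snd p \<in> L}"
  have S: "(x, y) \<in> S \<longleftrightarrow> x \<in> space M \<and> y = x \<or> (x, y) \<in> R \<and> x \<in> L \<and> y \<in> L" for x y
    using R_D by (auto simp: S_def space_pair_measure)
  have "S \<in> sets (M \<Otimes>\<^sub>M M)" unfolding S_def by measurable
  moreover have "equiv (space M) S"
    by (rule equivI) (auto simp: refl_on_def sym_def trans_def S R_sym dest: R_D intro: R_trans)
  moreover have "S \<subseteq> R" using R_equiv by (auto simp: S equiv_def refl_on_def)
  moreover have "finite (S `` {x})" if "x \<in> space M" for x
    by (rule finite_subset[of _ "{x} \<union> (if x \<in> L then R `` {x} \<inter> L else {})"]) (auto simp: S fin)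
  ultimately obtain \<pi> where \<pi>[measurable]: "\<pi> \<in> measurable M M"
    and \<pi>S: "\<And>x. x \<in> space M \<Longrightarrow> (x, \<pi> x) \<in> S" and \<pi>eq: "\<And>x y. (x, y) \<in> S \<Longrightarrow> \<pi> x = \<pi> y"
    using transversal[of S] by blast
  define D where "D = {x \<in> space M. x \<in> L \<and> \<pi> x = x}"
  have Dm[measurable]: "D \<in> sets M" unfolding D_def by measurable
  define sat where "sat A = {x \<in> space M. \<exists>n. f n x \<in> A}" for A
  have satm: "sat A \<in> sets M" if [measurable]: "A \<in> sets M" for A
    unfolding sat_def by measurable
  have sat: "x \<in> sat A \<longleftrightarrow> (\<exists>y\<in>A. (x, y) \<in> R)" for x A
    by (auto simp: sat_def R_eq)
  have sat_null: "emeasure M (sat A) = 0" if "A \<in> sets M" "emeasure M A = 0" for A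
    using null_saturation[of A] that by (auto simp: sat_def)
  have LD: "L \<subseteq> sat D"
  proof
    fix x assume x: "x \<in> L"
    then have "(x, \<pi> x) \<in> S" using \<pi>S Lsp by auto
    moreover from this have "\<pi> x = \<pi> (\<pi> x)" by (rule \<pi>eq)
    moreover have "(x, \<pi> x) \<in> R" using \<open>(x, \<pi> x) \<in> S\<close> \<open>S \<subseteq> R\<close> by blast
    ultimately have "\<pi> x \<in> D" "(x, \<pi> x) \<in> R" using x Lsp by (auto simp: D_def S)
    then show "x \<in> sat D" by (auto simp: sat)
  qed
  have "emeasure M D \<noteq> 0"
    using sat_null[OF Dm] emeasure_mono[OF LD satm[OF Dm]] pos by auto
  then obtain A where A: "A \<in> sets M" "A \<subseteq> D" "0 < emeasure M A" "emeasure M A < emeasure M D"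
    using atm Dm unfolding atomless_def by (metis not_gr_zero)
  have inv: "(\<forall>(x, y)\<in>R. x \<in> sat C \<longleftrightarrow> y \<in> sat C)" for C
    by (auto simp: sat intro: R_trans R_sym)
  have pos_sat: "emeasure M (space M - sat C) = 0" if C: "C \<in> sets M" "C \<subseteq> D" "emeasure M C \<noteq> 0" for C
  proof -
    have "x \<in> sat C" if "x \<in> C" for x
      unfolding sat using that C(2) R_equiv by (intro bexI[of _ x]) (auto simp: D_def equiv_def refl_on_def)
    then have "C \<subseteq> sat C" by blast
    then have "emeasure M (sat C) \<noteq> 0" using emeasure_mono[OF _ satm[OF C(1)]] C(3) by fastforce
    then show ?thesis using erg satm[OF C(1)] inv[of C] unfolding ergodic_rel_def by blast
  qed
  have "emeasure M (D - A) \<noteq> 0"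
    using A emeasure_Diff[of M A D] by (auto simp: diff_eq_0_iff_ennreal)
  then have "space M - sat A \<in> null_sets M" "space M - sat (D - A) \<in> null_sets M"
    using pos_sat[of A] pos_sat[of "D - A"] A satm by (auto simp: null_sets_def)
  then have "(space M - sat A) \<union> (space M - sat (D - A)) \<in> null_sets M" by (rule null_sets.Un)
  moreover have "sat A \<inter> sat (D - A) = {}"
  proof -
    have False if "(x, y) \<in> R" "y \<in> A" "(x, z) \<in> R" "z \<in> D - A" for x y z
    proof -
      have "(y, z) \<in> R" using that R_sym R_trans by blast
      then have "(y, z) \<in> S" using that A(2) by (auto simp: S D_def)
      then have "\<pi> y = \<pi> z" by (rule \<pi>eq)
      then show False using that A(2) by (auto simp: D_def)
    qed
    then show ?thesis by (simp add: disjoint_iff sat) blast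
  qed
  then have "(space M - sat A) \<union> (space M - sat (D - A)) = space M" by auto
  ultimately show False by (simp add: null_sets_def emeasure_space_1)
qed

section \<open>Matchings, and the enlargement of finite relations\<close>

text \<open>Stage i decodes to a pair (n, j) and matches x with \<open>f n x\<close> if both are
  still free, \<open>E\<close>-related, and separated by \<open>B j\<close> with x inside. This
  orientation keeps the sources and targets of a stage disjoint, and \<open>f n\<close> is
  injective, so no point gets two partners. A related pair inside \<open>L\<close> would have been
  matched at the stage that encodes its map and a set separating it.\<close>

lemma matching:
  assumes D[measurable]: "D \<in> sets M"
    and Em[measurable]: "\<And>n. Measurable.pred M (\<lambda>x. E x (f n x))"
    and Es: "\<And>x y. E x y \<longleftrightarrow> E y x"
  shows "\<exists>\<psi>\<in>measurable M M. \<exists>L\<in>sets M. L \<subseteq> D \<and>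
    (\<forall>x\<in>D - L. \<psi> x \<in> D - L \<and> \<psi> (\<psi> x) = x \<and> \<psi> x \<noteq> x \<and> (x, \<psi> x) \<in> R \<and> E x (\<psi> x)) \<and>
    (\<forall>x\<in>space M - (D - L). \<psi> x = x) \<and>
    (\<forall>x\<in>L. \<forall>y\<in>L. (x, y) \<in> R \<longrightarrow> x \<noteq> y \<longrightarrow> \<not> E x y)"
proof -
  have Dsp: "D \<subseteq> space M" using sets.sets_into_space[OF D] .
  define p where "p i U x y \<longleftrightarrow> x \<in> U \<and> y \<in> U \<and> x \<in> B (snd (prod_decode i)) \<and>
    y \<notin> B (snd (prod_decode i)) \<and> E x y \<and> y = f (fst (prod_decode i)) x" for i U x y
  define U where "U = rec_nat D (\<lambda>i U. {x \<in> U. \<not> (\<exists>y. p i U x y) \<and> \<not> (\<exists>y. p i U y x)})"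
  have U0: "U 0 = D" by (simp add: U_def)
  have U_Suc: "U (Suc i) = {x \<in> U i. \<not> (\<exists>y. p i (U i) x y) \<and> \<not> (\<exists>y. p i (U i) y x)}" for i
    by (simp add: U_def)
  have Uanti: "i \<le> j \<Longrightarrow> U j \<subseteq> U i" for i j
    by (induction rule: dec_induct) (auto simp: U_Suc)
  have USp: "U i \<subseteq> space M" for i using Uanti[of 0 i] U0 Dsp by auto
  have Um[measurable]: "U i \<in> sets M" for i
  proof (induction i)
    case (Suc i)
    note [measurable] = Suc
    define n where "n = fst (prod_decode i)"
    have 1: "(\<exists>y. p i (U i) x y) \<longleftrightarrow> f n x \<in> U i \<and> x \<in> B (snd (prod_decode i)) \<and>
      f n x \<notin> B (snd (prod_decode i)) \<and> E x (f n x)" if "x \<in> U i" for x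
      using that by (auto simp: p_def n_def)
    \<comment> \<open>The only possible source of x at this stage is \<open>f (\<iota> n) x\<close>.
      This removes the quantifier over points, and symmetry of \<open>E\<close> leaves the one form
      whose measurability is assumed.\<close>
    have 2: "(\<exists>y. p i (U i) y x) \<longleftrightarrow> f (\<iota> n) x \<in> U i \<and> f (\<iota> n) x \<in> B (snd (prod_decode i)) \<and>
      x \<notin> B (snd (prod_decode i)) \<and> E x (f (\<iota> n) x)" (is "?l \<longleftrightarrow> ?r") if x: "x \<in> U i" for x
    proof
      assume ?l
      then obtain y where y: "p i (U i) y x" ..
      then have "y \<in> space M" "x = f n y" using USp by (auto simp: p_def n_def)
      then have "y = f (\<iota> n) x" by (simp add: inv_f)
      then show ?r using y Es[of y x] by (auto simp: p_def)
    next
      assume r: ?r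
      have "x = f n (f (\<iota> n) x)" using x USp[of i] f_inv by auto
      then have "p i (U i) (f (\<iota> n) x) x" using r x Es[of x "f (\<iota> n) x"] by (simp add: p_def n_def)
      then show ?l ..
    qed
    have "U (Suc i) = {x \<in> space M. x \<in> U i \<and>
      \<not> (f n x \<in> U i \<and> x \<in> B (snd (prod_decode i)) \<and> f n x \<notin> B (snd (prod_decode i)) \<and> E x (f n x)) \<and>
      \<not> (f (\<iota> n) x \<in> U i \<and> f (\<iota> n) x \<in> B (snd (prod_decode i)) \<and> x \<notin> B (snd (prod_decode i)) \<and>
        E x (f (\<iota> n) x))}"
      unfolding U_Suc by (rule Collect_cong) (use 1 2 USp[of i] in blast)
    also have "\<dots> \<in> sets M" by measurable
    finally show ?case .
  qed (simp add: U0)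
  define q where "q x y \<longleftrightarrow> (\<exists>i. p i (U i) x y \<or> p i (U i) y x)" for x y
  define L where "L = (\<Inter>i. U i)"
  have Lm[measurable]: "L \<in> sets M" unfolding L_def by measurable
  have LD: "L \<subseteq> D" using U0 by (auto simp: L_def)
  have q_sym: "q x y \<Longrightarrow> q y x" for x y by (auto simp: q_def)
  have pU: "x \<in> U i \<and> y \<in> U i \<and> x \<notin> U (Suc i) \<and> y \<notin> U (Suc i)" if "p i (U i) x y" for i x y
    using that by (auto simp: p_def U_Suc)
  have q_D: "x \<in> D - L" if "q x y" for x y
    using that pU Uanti[of 0] U0 unfolding q_def L_def by blast
  have q_E: "(x, y) \<in> R \<and> E x y \<and> x \<noteq> y" if "q x y" for x y
  proof -
    have *: "(x, y) \<in> R \<and> (y, x) \<in> R \<and> E x y \<and> E y x \<and> x \<noteq> y" if "p i (U i) x y" for i x y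
      using that USp[of i] Es[of x y] R_f[of x] R_sym[of x y] by (auto simp: p_def)
    show ?thesis using that * unfolding q_def by blast
  qed
  have q_ex: "\<exists>y. q x y" if x: "x \<in> D - L" for x
  proof -
    define i where "i = (LEAST i. x \<notin> U i)"
    have "\<exists>i. x \<notin> U i" using x by (auto simp: L_def)
    then have i: "x \<notin> U i" unfolding i_def by (rule LeastI_ex)
    then have "i \<noteq> 0" using x U0 by (metis DiffD1)
    then obtain k where k: "i = Suc k" by (cases i) auto
    then have "x \<in> U k" using not_less_Least[of k "\<lambda>i. x \<notin> U i"] by (auto simp: i_def)
    then show ?thesis using i unfolding k by (auto simp: U_Suc q_def)
  qed
  have q_uniq: "y = z" if qy: "q x y" and qz: "q x z" for x y z
  proof -
    obtain i where i: "p i (U i) x y \<or> p i (U i) y x" using qy by (auto simp: q_def)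
    obtain j where j: "p j (U j) x z \<or> p j (U j) z x" using qz by (auto simp: q_def)
    have xi: "x \<in> U i" "x \<notin> U (Suc i)" and xj: "x \<in> U j" "x \<notin> U (Suc j)"
      using i j pU by blast+
    have "\<not> i < j" "\<not> j < i"
      using Uanti[of "Suc i" j] Uanti[of "Suc j" i] xi xj by auto
    then have "i = j" by simp
    moreover have "y = z" if "p i (U i) y x" "p i (U i) z x"
    proof -
      have "y \<in> space M" "z \<in> space M" "f (fst (prod_decode i)) y = f (fst (prod_decode i)) z"
        using that USp by (auto simp: p_def)
      then show ?thesis using inv_f by metis
    qed
    ultimately show ?thesis using i j by (auto simp: p_def)
  qed
  have [measurable]: "Measurable.pred M (\<lambda>x. q x (f n x))" for n
    unfolding q_def p_def Es[of "f n x" x for x] by measurable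
  define \<psi> where "\<psi> x = (if x \<in> D - L then f (LEAST n. q x (f n x)) x else x)" for x
  have \<psi>m: "\<psi> \<in> measurable M M" unfolding \<psi>_def by measurable
  have q\<psi>: "q x (\<psi> x)" if x: "x \<in> D - L" for x
  proof -
    obtain y where y: "q x y" using q_ex[OF x] by blast
    then obtain n where "y = f n x" using q_E R_E by blast
    then have "\<exists>n. q x (f n x)" using y by blast
    then have "q x (f (LEAST n. q x (f n x)) x)" by (rule LeastI_ex)
    then show ?thesis using x by (simp add: \<psi>_def)
  qed
  have "\<psi> x \<in> D - L \<and> \<psi> (\<psi> x) = x \<and> \<psi> x \<noteq> x \<and> (x, \<psi> x) \<in> R \<and> E x (\<psi> x)" if x: "x \<in> D - L" for x
  proof -
    have 1: "q (\<psi> x) x" by (rule q_sym[OF q\<psi>[OF x]])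
    have 2: "\<psi> x \<in> D - L" by (rule q_D[OF 1])
    have "\<psi> (\<psi> x) = x" by (rule q_uniq[OF q\<psi>[OF 2] 1])
    then show ?thesis using 2 q_E[OF q\<psi>[OF x]] by (intro conjI) auto
  qed
  moreover have "\<not> E x y" if xy: "x \<in> L" "y \<in> L" "(x, y) \<in> R" "x \<noteq> y" for x y
  proof
    assume E: "E x y"
    have sp: "x \<in> space M" "y \<in> space M" using R_D[OF xy(3)] by auto
    obtain n where n: "y = f n x" using R_E[OF xy(3)] by blast
    obtain j where j: "x \<in> B j" "y \<notin> B j" using B_sep[OF sp xy(4)] by blast
    let ?i = "prod_encode (n, j)"
    have "x \<in> U ?i" "y \<in> U ?i" "x \<in> U (Suc ?i)" using xy by (auto simp: L_def)
    moreover have "p ?i (U ?i) x y" using calculation E n j by (simp add: p_def)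
    ultimately show False by (auto simp: U_Suc)
  qed
  moreover have "\<psi> x = x" if "x \<in> space M - (D - L)" for x using that by (auto simp: \<psi>_def)
  ultimately show ?thesis
    by (intro bexI[OF _ \<psi>m] bexI[OF _ Lm] conjI LD) auto
qed

text \<open>Each class of \<open>S\<close> is merged with at most one other class of the same shape, far away with
  respect to \<open>f 0, \<dots>, f (N - 1)\<close>. The shape of a class is the set of first indices
  of its elements as seen from its representative; there are countably many shapes, and a leftover
  of fixed shape meets every \<open>R\<close>-class in a finite set, hence is null.\<close>

lemma spread_extension:
  assumes erg: "ergodic_rel M R" and atm: "atomless M"
    and S[measurable]: "S \<in> sets (M \<Otimes>\<^sub>M M)" and eq: "equiv (space M) S" and SR: "S \<subseteq> R"
    and fin_classes: "\<forall>x\<in>space M. finite (S `` {x})"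
  shows "\<exists>S'\<in>sets (M \<Otimes>\<^sub>M M). equiv (space M) S' \<and> S' \<subseteq> R \<and> S \<subseteq> S' \<and>
    (\<forall>x\<in>space M. finite (S' `` {x})) \<and>
    (\<forall>x\<in>space M. \<forall>j<N. (x, f j x) \<in> S' \<longrightarrow> (x, f j x) \<in> S) \<and>
    (\<exists>P\<in>sets M. \<exists>\<theta>\<in>measurable M M. space M - P \<in> null_sets M \<and> inj_on \<theta> P \<and>
      (\<forall>x\<in>P. (x, \<theta> x) \<in> S' - S))"
proof -
  have fin: "finite (S `` {x})" if "x \<in> space M" for x using fin_classes that by blast
  obtain \<pi> where \<pi>[measurable]: "\<pi> \<in> measurable M M"
    and \<pi>S: "\<And>x. x \<in> space M \<Longrightarrow> (x, \<pi> x) \<in> S" and \<pi>eq: "\<And>x y. (x, y) \<in> S \<Longrightarrow> \<pi> x = \<pi> y"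
    using transversal[OF S eq SR fin] by blast
  have Sr: "x \<in> space M \<Longrightarrow> (x, x) \<in> S" for x using eq by (simp add: equiv_def refl_on_def)
  have Ss: "(x, y) \<in> S \<Longrightarrow> (y, x) \<in> S" for x y using eq unfolding equiv_def by (blast dest: symD)
  have St: "(x, y) \<in> S \<Longrightarrow> (y, z) \<in> S \<Longrightarrow> (x, z) \<in> S" for x y z
    using eq unfolding equiv_def by (blast dest: transD)
  have \<pi>sp[simp]: "\<pi> x \<in> space M" if "x \<in> space M" for x by (rule measurable_space[OF \<pi> that])
  have \<pi>\<pi>[simp]: "\<pi> (\<pi> x) = \<pi> x" if "x \<in> space M" for x using \<pi>eq[OF \<pi>S[OF that]] by simp
  have S_iff: "(x, y) \<in> S \<longleftrightarrow> \<pi> x = \<pi> y" if "x \<in> space M" "y \<in> space M" for x y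
    using \<pi>S[OF that(1)] \<pi>S[OF that(2)] \<pi>eq Ss St by metis
  define D where "D = {x \<in> space M. \<pi> x = x}"
  have Dm[measurable]: "D \<in> sets M" unfolding D_def by measurable
  have \<pi>D: "\<pi> x \<in> D" if "x \<in> space M" for x using that by (simp add: D_def)
  \<comment> \<open>For a representative d, this says that \<open>f a d\<close> belongs to the class
    of d and that a is its first index. The indices satisfying it are the shape of the class and
    label its points without repetition.\<close>
  define idx where "idx d a \<longleftrightarrow> \<pi> (f a d) = d \<and> (\<forall>b<a. f b d \<noteq> f a d)" for d a
  \<comment> \<open>The second half asks that no \<open>f j\<close> with j < N leads from one class
    to the other. Both directions are required so that \<open>E\<close> is symmetric.\<close>
  define E where "E d e \<longleftrightarrow> (\<forall>a. idx d a \<longleftrightarrow> idx e a) \<and>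
    (\<forall>a b. \<pi> (f a d) = d \<longrightarrow> \<pi> (f b e) = e \<longrightarrow>
      (\<forall>j<N. f b e \<noteq> f j (f a d) \<and> f a d \<noteq> f j (f b e)))" for d e
  have Esym: "E d e \<longleftrightarrow> E e d" for d e unfolding E_def by blast
  have idxm[measurable]: "Measurable.pred M (\<lambda>x. idx x a)" for a
    unfolding idx_def by measurable
  have idxfm[measurable]: "Measurable.pred M (\<lambda>x. idx (f n x) a)" for a n
    unfolding idx_def by measurable
  have Em: "Measurable.pred M (\<lambda>x. E x (f n x))" for n
    unfolding E_def by measurable
  obtain \<psi> L where \<psi>[measurable]: "\<psi> \<in> measurable M M" and L[measurable]: "L \<in> sets M" and LD: "L \<subseteq> D"
    and \<psi>1: "\<forall>x\<in>D - L. \<psi> x \<in> D - L \<and> \<psi> (\<psi> x) = x \<and> \<psi> x \<noteq> x \<and> (x, \<psi> x) \<in> R \<and> E x (\<psi> x)"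
    and \<psi>2: "\<forall>x\<in>space M - (D - L). \<psi> x = x"
    and ind: "\<forall>x\<in>L. \<forall>y\<in>L. (x, y) \<in> R \<longrightarrow> x \<noteq> y \<longrightarrow> \<not> E x y"
    using matching[where E=E, OF Dm Em Esym] by (elim bexE conjE) (rule that)
  have \<psi>sp[simp]: "\<psi> x \<in> space M" if "x \<in> space M" for x by (rule measurable_space[OF \<psi> that])
  have \<psi>\<psi>: "\<psi> (\<psi> x) = x" if "x \<in> space M" for x using \<psi>1 \<psi>2 that by (cases "x \<in> D - L") auto
  have \<psi>D: "\<psi> x \<in> D" if "x \<in> D" for x using \<psi>1 \<psi>2 that by (cases "x \<in> D - L") (auto simp: D_def)
  have \<psi>R: "(x, \<psi> x) \<in> R" if "x \<in> space M" for x
  proof (cases "x \<in> D - L")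
    case False
    then show ?thesis using \<psi>2 that Sr SR by auto
  qed (use \<psi>1 in blast)
  have \<pi>\<psi>: "\<pi> (\<psi> (\<pi> x)) = \<psi> (\<pi> x)" if "x \<in> space M" for x
    using \<psi>D[OF \<pi>D[OF that]] by (simp add: D_def)
  have index: "\<exists>a. x = f a (\<pi> x)" if x: "x \<in> space M" for x
    using R_E[of "\<pi> x" x] Ss[OF \<pi>S[OF x]] SR by blast
  define r where "r x = (LEAST a. x = f a (\<pi> x))" for x
  have r: "x = f (r x) (\<pi> x)" if "x \<in> space M" for x
    unfolding r_def by (rule LeastI_ex[OF index[OF that]])
  have r_idx: "idx (\<pi> x) (r x)" if x: "x \<in> space M" for x
    unfolding idx_def using r[OF x] not_less_Least[of _ "\<lambda>a. x = f a (\<pi> x)"]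
    by (metis r_def)

  \<comment> \<open>As \<open>\<psi>\<close> is an involution, at most two classes are merged and
    transitivity holds. A representative in \<open>L\<close> is fixed by \<open>\<psi>\<close>, so
    its class stays as it was.\<close>
  define S' where "S' = {p \<in> space (M \<Otimes>\<^sub>M M). \<pi> (snd p) = \<pi> (fst p) \<or> \<pi> (snd p) = \<psi> (\<pi> (fst p))}"
  have S': "(x, y) \<in> S' \<longleftrightarrow> x \<in> space M \<and> y \<in> space M \<and> (\<pi> y = \<pi> x \<or> \<pi> y = \<psi> (\<pi> x))" for x y
    by (auto simp: S'_def space_pair_measure)
  have S'm: "S' \<in> sets (M \<Otimes>\<^sub>M M)" unfolding S'_def by measurable
  have S'eq: "equiv (space M) S'"
  proof (rule equivI)
    show "sym S'" by (auto simp: sym_def S' \<psi>\<psi>)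
    show "trans S'" unfolding trans_def
    proof (intro allI impI)
      fix x y z assume "(x, y) \<in> S'" "(y, z) \<in> S'"
      then show "(x, z) \<in> S'" by (auto simp: S' \<psi>\<psi>)
    qed
  qed (auto simp: refl_on_def S')
  have SS': "S \<subseteq> S'"
  proof
    fix p assume p: "p \<in> S"
    obtain x y where xy: "p = (x, y)" by (cases p)
    have "x \<in> space M" "y \<in> space M" using p xy SR R_D by auto
    then show "p \<in> S'" using p xy \<pi>eq by (auto simp: S')
  qed
  have S'R: "S' \<subseteq> R"
  proof
    fix p assume p: "p \<in> S'"
    obtain x y where xy: "p = (x, y)" by (cases p)
    have sp: "x \<in> space M" "y \<in> space M" using p xy S' by auto
    have 1: "(x, \<pi> x) \<in> R" "(\<pi> y, y) \<in> R" using \<pi>S[OF sp(1)] Ss[OF \<pi>S[OF sp(2)]] SR by auto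
    have "(\<pi> x, \<pi> y) \<in> R" using p \<psi>R[of "\<pi> x"] Sr[of "\<pi> x"] SR sp by (auto simp: xy S')
    then show "p \<in> R" unfolding xy using 1 R_trans by blast
  qed
  have S'fin: "finite (S' `` {x})" if x: "x \<in> space M" for x
  proof (rule finite_subset)
    show "S' `` {x} \<subseteq> S `` {x} \<union> S `` {\<psi> (\<pi> x)}"
    proof
      fix y assume "y \<in> S' `` {x}"
      then have y: "y \<in> space M" "\<pi> y = \<pi> x \<or> \<pi> y = \<psi> (\<pi> x)" by (auto simp: S')
      then show "y \<in> S `` {x} \<union> S `` {\<psi> (\<pi> x)}" using x \<pi>\<psi>[OF x] by (auto simp: S_iff)
    qed
    show "finite (S `` {x} \<union> S `` {\<psi> (\<pi> x)})" using fin x by simp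
  qed
  have avoid: "(x, f j x) \<in> S" if x: "x \<in> space M" and j: "j < N" and S'x: "(x, f j x) \<in> S'" for x j
  proof (rule ccontr)
    assume nS: "(x, f j x) \<notin> S"
    let ?y = "f j x"
    have y: "?y \<in> space M" using x by simp
    have ne: "\<pi> ?y \<noteq> \<pi> x" using nS x y by (simp add: S_iff)
    then have yx: "\<pi> ?y = \<psi> (\<pi> x)" using S'x by (auto simp: S')
    then have "\<pi> x \<in> D - L" using ne \<psi>2 x by (metis DiffI \<pi>sp)
    then have E: "E (\<pi> x) (\<pi> ?y)" using \<psi>1 yx by auto
    have "\<pi> (f (r x) (\<pi> x)) = \<pi> x" "\<pi> (f (r ?y) (\<pi> ?y)) = \<pi> ?y"
      using r[OF x] r[OF y] by simp_all
    then have "f (r ?y) (\<pi> ?y) \<noteq> f j (f (r x) (\<pi> x))" using E j unfolding E_def by blast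
    then show False using r[OF x] r[OF y] by simp
  qed

  have Lnull: "L \<in> null_sets M"
  proof -
    define LI where "LI I = {x \<in> space M. x \<in> L \<and> (\<forall>a. idx x a \<longleftrightarrow> a \<in> I)}" for I
    have LIm[measurable]: "LI I \<in> sets M" for I unfolding LI_def by measurable
    have "LI I \<in> null_sets M" for I
    proof -
      \<comment> \<open>Two unmatched representatives of equal shape in one class of
        \<open>R\<close> fail \<open>E\<close> by proximity alone: some \<open>f j\<close> with j <
        N links their classes. Starting from the finite class of x, only finitely many classes can
        be reached by such a link or by its inverse.\<close>
      have "finite (R `` {x} \<inter> LI I)" if x: "x \<in> LI I" for x
      proof (rule finite_subset)
        let ?C = "S `` {x}"
        have xsp: "x \<in> space M" and xL: "x \<in> L" using x by (auto simp: LI_def)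
        then have \<pi>x: "\<pi> x = x" using LD by (auto simp: D_def)
        show "finite (insert x (\<Union>j<N. \<pi> ` f j ` ?C \<union> \<pi> ` f (\<iota> j) ` ?C))"
          using fin[OF xsp] by simp
        show "R `` {x} \<inter> LI I \<subseteq> insert x (\<Union>j<N. \<pi> ` f j ` ?C \<union> \<pi> ` f (\<iota> j) ` ?C)"
        proof
          fix y assume y: "y \<in> R `` {x} \<inter> LI I"
          then have ysp: "y \<in> space M" and yL: "y \<in> L" and xy: "(x, y) \<in> R" by (auto simp: LI_def)
          have idxxy: "\<forall>a. idx x a \<longleftrightarrow> idx y a" using x y by (auto simp: LI_def)
          show "y \<in> insert x (\<Union>j<N. \<pi> ` f j ` ?C \<union> \<pi> ` f (\<iota> j) ` ?C)"
          proof (cases "y = x")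
            case False
            then have "\<not> E x y" using ind xL yL xy by blast
            then obtain a b j where *: "\<pi> (f a x) = x" "\<pi> (f b y) = y" "j < N"
              "f b y = f j (f a x) \<or> f a x = f j (f b y)"
              unfolding E_def using idxxy by blast
            have u: "f a x \<in> ?C" using xsp \<pi>x *(1) by (simp add: S_iff)
            have "f b y = f j (f a x) \<or> f b y = f (\<iota> j) (f a x)"
              using *(4) inv_f[of "f b y" j] ysp by auto
            then have "y \<in> \<pi> ` f j ` ?C \<union> \<pi> ` f (\<iota> j) ` ?C"
              using *(2) u by (metis UnCI imageI)
            then show ?thesis using *(3) by blast
          qed simp
        qed
      qed
      then have "emeasure M (LI I) = 0" by (rule finite_classes_null[OF erg atm LIm])
      then show ?thesis by (simp add: null_sets_def)
    qed
    then have "(\<Union>I\<in>Collect finite. LI I) \<in> null_sets M"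
      by (intro null_sets_UN' countable_Collect_finite)
    moreover have "L \<subseteq> (\<Union>I\<in>Collect finite. LI I)"
    proof
      fix x assume x: "x \<in> L"
      then have xsp: "x \<in> space M" and "\<pi> x = x" using LD by (auto simp: D_def)
      have "inj_on (\<lambda>a. f a x) {a. idx x a}"
        by (rule inj_onI) (metis idx_def linorder_neqE_nat mem_Collect_eq)
      moreover have "(\<lambda>a. f a x) ` {a. idx x a} \<subseteq> S `` {x}"
        using xsp \<open>\<pi> x = x\<close> by (auto simp: S_iff idx_def)
      ultimately have "finite {a. idx x a}"
        using fin[OF xsp] by (metis finite_imageD finite_subset)
      moreover have "x \<in> LI {a. idx x a}" using x xsp by (simp add: LI_def)
      ultimately show "x \<in> (\<Union>I\<in>Collect finite. LI I)" by blast
    qed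
    ultimately show ?thesis by (rule null_sets_subset[OF _ L])
  qed

  define P where "P = {x \<in> space M. \<pi> x \<notin> L}"
  have Pm: "P \<in> sets M" unfolding P_def by measurable
  have Pnull: "space M - P \<in> null_sets M"
  proof (rule null_sets_subset[OF null_saturation[OF Lnull]])
    show "space M - P \<subseteq> {x \<in> space M. \<exists>n. f n x \<in> L}"
    proof
      fix x assume "x \<in> space M - P"
      then have x: "x \<in> space M" "\<pi> x \<in> L" by (auto simp: P_def)
      then obtain n where "\<pi> x = f n x" using \<pi>S SR R_E by blast
      then show "x \<in> {x \<in> space M. \<exists>n. f n x \<in> L}" using x by auto
    qed
  qed (use Pm in measurable)
  \<comment> \<open>A point goes to the point with the same label \<open>r x\<close> in the partner
    class. Equal shapes make this label available there, and labels determine points within a class,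
    whence injectivity.\<close>
  define \<theta> where "\<theta> x = f (r x) (\<psi> (\<pi> x))" for x
  have \<theta>m: "\<theta> \<in> measurable M M"
    unfolding \<theta>_def r_def by (rule measurable_compose_countable[of "\<lambda>n x. f n (\<psi> (\<pi> x))"]) measurable
  have \<theta>: "\<theta> x \<in> space M \<and> \<pi> (\<theta> x) = \<psi> (\<pi> x) \<and> \<psi> (\<pi> x) \<noteq> \<pi> x \<and> idx (\<psi> (\<pi> x)) (r x)"
    if "x \<in> P" for x
  proof -
    have x: "x \<in> space M" "\<pi> x \<in> D - L" using that \<pi>D by (auto simp: P_def)
    then have E: "E (\<pi> x) (\<psi> (\<pi> x))" "\<psi> (\<pi> x) \<noteq> \<pi> x" using \<psi>1 by auto
    then have i: "idx (\<psi> (\<pi> x)) (r x)" using r_idx[OF x(1)] by (simp add: E_def)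
    then show ?thesis using E x by (simp add: \<theta>_def idx_def)
  qed
  have \<theta>inj: "inj_on \<theta> P"
  proof (rule inj_onI)
    fix x y assume x: "x \<in> P" and y: "y \<in> P" and xy: "\<theta> x = \<theta> y"
    have sp: "x \<in> space M" "y \<in> space M" using x y by (auto simp: P_def)
    have "\<psi> (\<pi> x) = \<psi> (\<pi> y)" using \<theta>[OF x] \<theta>[OF y] xy by simp
    then have \<pi>xy: "\<pi> x = \<pi> y" using \<psi>\<psi> sp \<pi>sp by metis
    have "f (r x) (\<psi> (\<pi> x)) = f (r y) (\<psi> (\<pi> x))" using xy \<pi>xy by (simp add: \<theta>_def)
    moreover have "idx (\<psi> (\<pi> x)) (r x)" "idx (\<psi> (\<pi> x)) (r y)" using \<theta>[OF x] \<theta>[OF y] \<pi>xy by simp_all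
    ultimately have "r x = r y" unfolding idx_def by (metis linorder_neqE_nat)
    then show "x = y" using r[OF sp(1)] r[OF sp(2)] \<pi>xy by simp
  qed
  have \<theta>S: "\<forall>x\<in>P. (x, \<theta> x) \<in> S' - S"
  proof
    fix x assume x: "x \<in> P"
    then have "x \<in> space M" by (simp add: P_def)
    moreover have "\<pi> x \<noteq> \<psi> (\<pi> x)" using \<theta>[OF x] by metis
    ultimately show "(x, \<theta> x) \<in> S' - S" using \<theta>[OF x] by (simp add: S' S_iff)
  qed
  show ?thesis
    using S'eq S'R SS' S'fin avoid Pnull \<theta>inj \<theta>S
    by (intro bexI[OF _ S'm] bexI[OF _ Pm] bexI[OF _ \<theta>m] conjI) auto
qed

end

section \<open>Separability of the full group\<close>

text \<open>Boolean expressions in the generators \<open>B n\<close>: a countable index set for a dense family of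
  measurable sets.\<close>

datatype bexp = Gen nat | Neg bexp | Cup bexp bexp

instance bexp :: countable
  by countable_datatype

primrec bval :: "'a set \<Rightarrow> (nat \<Rightarrow> 'a set) \<Rightarrow> bexp \<Rightarrow> 'a set" where
  "bval X B (Gen n) = B n"
| "bval X B (Neg t) = X - bval X B t"
| "bval X B (Cup s t) = bval X B s \<union> bval X B t"

section \<open>Absolute continuity, and a criterion for nowhere density\<close>

text \<open>A counterexample yields sets of \<open>m\<close>-measure below \<open>(1/2) ^ k\<close>
  whose \<open>n\<close>-measure stays at least \<open>e\<close>. By Borel-Cantelli their limsup is
  null for \<open>m\<close>, hence for \<open>n\<close>, but continuity from above gives it
  \<open>n\<close>-measure at least \<open>e\<close>. This later turns closeness in the metric of
  \<open>m\<close> into a statement about most points.\<close>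

lemma absolutely_continuous_eps_delta:
  assumes m: "finite_measure m" and n: "finite_measure n" and sets: "sets n = sets m"
    and null: "null_sets m \<subseteq> null_sets n" and e: "e > 0"
  shows "\<exists>d>0. \<forall>A\<in>sets m. measure m A < d \<longrightarrow> measure n A < e"
proof (rule ccontr)
  interpret m: finite_measure m by fact
  interpret n: finite_measure n by fact
  assume not: "\<not> ?thesis"
  have "\<exists>A\<in>sets m. measure m A < (1/2) ^ k \<and> e \<le> measure n A" for k :: nat
  proof -
    have "(0::real) < (1/2) ^ k" by simp
    then show ?thesis using not by (meson not_less)
  qed
  then obtain A where A: "\<And>k. A k \<in> sets m" "\<And>k. measure m (A k) < (1/2) ^ k" "\<And>k. e \<le> measure n (A k)"
    by metis
  have "limsup A \<in> null_sets m"
  proof (rule borel_cantelli_limsup1)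
    show "summable (\<lambda>k. measure m (A k))"
      by (rule summable_comparison_test'[of "\<lambda>k. (1/2) ^ k" 0])
        (use A(2) in \<open>auto intro: less_imp_le\<close>)
  qed (use A(1) in \<open>auto simp: m.emeasure_finite less_top[symmetric]\<close>)
  then have "measure n (limsup A) = 0"
    using null by (auto simp: measure_eq_0_null_sets)
  moreover have "(\<lambda>k. measure n (\<Union>j\<in>{k..}. A j)) \<longlonglongrightarrow> measure n (\<Inter>k. \<Union>j\<in>{k..}. A j)"
  proof (rule n.finite_Lim_measure_decseq)
    show "range (\<lambda>k. \<Union>j\<in>{k..}. A j) \<subseteq> sets n" using A(1) sets by (auto intro!: sets.countable_UN')
    show "decseq (\<lambda>k. \<Union>j\<in>{k..}. A j)" by (intro decseq_SucI UN_mono) auto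
  qed
  then have "e \<le> measure n (\<Inter>k. \<Union>j\<in>{k..}. A j)"
  proof (rule LIMSEQ_le_const, intro exI[of _ 0] allI impI)
    fix k
    have "measure n (A k) \<le> measure n (\<Union>j\<in>{k..}. A j)"
      using A(1) sets by (intro n.finite_measure_mono) auto
    then show "e \<le> measure n (\<Union>j\<in>{k..}. A j)" using A(3)[of k] by linarith
  qed
  ultimately show False using e by (simp add: limsup_INF_SUP)
qed

text \<open>If the closure of \<open>E\<close> contained a ball of \<open>Y\<close>, then both u and
  v would be limits of \<open>E\<close>. The two-point form suits sets that may come close to either
  point separately, but not to both.\<close>

lemma (in Metric_space) nowhere_dense_in_subtopologyI:
  assumes Y: "Y \<subseteq> M" and E: "E \<subseteq> Y"
    and far: "\<And>y r. y \<in> Y \<Longrightarrow> r > 0 \<Longrightarrow> \<exists>u\<in>Y. \<exists>v\<in>Y. \<exists>\<rho>>0. d y u < r \<and> d y v < r \<and>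
      (\<forall>a\<in>E. \<forall>b\<in>E. d u a < \<rho> \<longrightarrow> d v b < \<rho> \<longrightarrow> False)"
  shows "nowhere_dense_in (subtopology mtopology Y) E"
  unfolding nowhere_dense_in_def
proof
  show "E \<subseteq> topspace (subtopology mtopology Y)" using Y E by auto
  show "subtopology mtopology Y interior_of (subtopology mtopology Y closure_of E) = {}"
  proof (rule equals0I)
    fix z assume "z \<in> subtopology mtopology Y interior_of (subtopology mtopology Y closure_of E)"
    then obtain T where T: "openin (subtopology mtopology Y) T" "z \<in> T"
      "T \<subseteq> subtopology mtopology Y closure_of E"
      by (auto simp: interior_of_def)
    then obtain U where U: "openin mtopology U" "T = U \<inter> Y" by (auto simp: openin_subtopology)
    then obtain r where r: "r > 0" "mball z r \<subseteq> U" using T(2) by (auto simp: openin_mtopology)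
    have z: "z \<in> Y" using T(2) U(2) by simp
    obtain u v \<rho> where uv: "u \<in> Y" "v \<in> Y" "\<rho> > 0" "d z u < r" "d z v < r"
      and no: "\<forall>a\<in>E. \<forall>b\<in>E. d u a < \<rho> \<longrightarrow> d v b < \<rho> \<longrightarrow> False"
      using far[OF z r(1)] by blast
    have "u \<in> T" "v \<in> T" using uv z r(2) Y U(2) by (auto simp: subset_iff)
    then have "u \<in> mtopology closure_of (Y \<inter> E)" "v \<in> mtopology closure_of (Y \<inter> E)"
      using T(3) by (auto simp: closure_of_subtopology)
    then show False using no uv(3) unfolding metric_closure_of by fastforce
  qed
qed

context countable_pmp
begin

section \<open>Approximation of sets, index functions and full group elements\<close>

abbreviation "bv \<equiv> bval (space M) B"

lemma bval_sets[measurable]: "bv t \<in> sets M"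
  by (induction t) auto

text \<open>The approximable sets form a sigma-algebra that contains the generators. A countable
  union is replaced by a finite partial union that misses little measure.\<close>

lemma bval_approx:
  assumes A: "A \<in> sets M" and e: "e > 0"
  shows "\<exists>t. measure M (sym_diff A (bv t)) < e"
proof -
  define P where "P A \<longleftrightarrow> A \<in> sets M \<and> (\<forall>e>0. \<exists>t. measure M (sym_diff A (bv t)) < e)" for A
  have empty: "P {}"
  proof -
    have "bv (Neg (Cup (Gen 0) (Neg (Gen 0)))) = {}"
      using sets.sets_into_space[OF B_sets] by auto
    then show ?thesis unfolding P_def by (metis Diff_empty Un_empty measure_empty sets.empty_sets)
  qed
  have union: "P (A \<union> C)" if AC: "P A" "P C" for A C
    unfolding P_def
  proof (intro conjI allI impI)
    show "A \<union> C \<in> sets M" using AC by (auto simp: P_def)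
    fix e :: real assume "e > 0"
    then have "e / 2 > 0" by simp
    then obtain s t where st: "measure M (sym_diff A (bv s)) < e / 2" "measure M (sym_diff C (bv t)) < e / 2"
      using AC unfolding P_def by blast
    have [measurable]: "A \<in> sets M" "C \<in> sets M" using AC by (auto simp: P_def)
    have "measure M (sym_diff (A \<union> C) (bv (Cup s t))) \<le> measure M (sym_diff A (bv s) \<union> sym_diff C (bv t))"
      by (rule finite_measure_mono) auto
    also have "\<dots> \<le> measure M (sym_diff A (bv s)) + measure M (sym_diff C (bv t))"
      by (rule measure_Un_le) measurable
    also have "\<dots> < e" using st by simp
    finally show "\<exists>t. measure M (sym_diff (A \<union> C) (bv t)) < e" by blast
  qed
  have "A \<in> sigma_sets (space M) (range B)" using A B_gen by simp
  then have "P A"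
  proof induction
    case (Basic a)
    then obtain n where n: "a = B n" by auto
    show ?case unfolding P_def
    proof (intro conjI allI impI)
      show "a \<in> sets M" by (simp add: n)
      fix e :: real assume "e > 0"
      then show "\<exists>t. measure M (sym_diff a (bv t)) < e" by (intro exI[of _ "Gen n"]) (simp add: n)
    qed
  next
    case Empty
    show ?case by (rule empty)
  next
    case (Compl a)
    show ?case unfolding P_def
    proof (intro conjI allI impI)
      show "space M - a \<in> sets M" using Compl by (auto simp: P_def)
      fix e :: real assume "e > 0"
      then obtain t where t: "measure M (sym_diff a (bv t)) < e" using Compl by (auto simp: P_def)
      have "a \<subseteq> space M" using Compl by (auto simp: P_def dest: sets.sets_into_space)
      then have "sym_diff (space M - a) (bv (Neg t)) = sym_diff a (bv t)"
        using sets.sets_into_space[OF bval_sets[of t]] by auto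
      then show "\<exists>t. measure M (sym_diff (space M - a) (bv t)) < e" using t by metis
    qed
  next
    case (Union a)
    have fin: "P (\<Union>i<n. a i)" for n :: nat
    proof (induction n)
      case (Suc n)
      have "(\<Union>i<Suc n. a i) = (\<Union>i<n. a i) \<union> a n" by (auto simp: lessThan_Suc)
      then show ?case using union[OF Suc Union(2)[of n]] by simp
    qed (use empty in simp)
    have am[measurable]: "a i \<in> sets M" for i using Union by (simp add: P_def)
    show ?case unfolding P_def
    proof (intro conjI allI impI)
      show "\<Union> (range a) \<in> sets M" by measurable
      fix e :: real assume e: "e > 0"
      have "(\<lambda>n. measure M (\<Union>i<n. a i)) \<longlonglongrightarrow> measure M (\<Union>n. \<Union>i<n. a i)"
        by (rule finite_Lim_measure_incseq) (auto simp: incseq_def intro: less_le_trans)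
      also have "(\<Union>n. \<Union>i<n. a i) = \<Union> (range a)" by auto
      finally have "\<forall>\<^sub>F n in sequentially. dist (measure M (\<Union>i<n. a i)) (measure M (\<Union> (range a))) < e / 2"
        using e by (intro tendstoD) auto
      then obtain n where n: "dist (measure M (\<Union>i<n. a i)) (measure M (\<Union> (range a))) < e / 2"
        by (auto simp: eventually_sequentially)
      have "measure M (\<Union> (range a) - (\<Union>i<n. a i)) = measure M (\<Union> (range a)) - measure M (\<Union>i<n. a i)"
        by (rule finite_measure_Diff) auto
      then have d: "measure M (\<Union> (range a) - (\<Union>i<n. a i)) < e / 2"
        using n abs_le_D2[OF less_imp_le] unfolding dist_real_def by linarith
      obtain t where t: "measure M (sym_diff (\<Union>i<n. a i) (bv t)) < e / 2"
        using fin[of n] e unfolding P_def by (meson half_gt_zero)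
      have "measure M (sym_diff (\<Union> (range a)) (bv t)) \<le>
          measure M ((\<Union> (range a) - (\<Union>i<n. a i)) \<union> sym_diff (\<Union>i<n. a i) (bv t))"
        by (rule finite_measure_mono) auto
      also have "\<dots> \<le> measure M (\<Union> (range a) - (\<Union>i<n. a i)) + measure M (sym_diff (\<Union>i<n. a i) (bv t))"
        by (rule measure_Un_le) measurable
      also have "\<dots> < e" using d t by simp
      finally show "\<exists>t. measure M (sym_diff (\<Union> (range a)) (bv t)) < e" by blast
    qed
  qed
  then show ?thesis using e by (simp add: P_def)
qed

text \<open>A finite list codes an index function with finitely many values: the position of the
  first expression containing x, with \<open>length c\<close> as the default. There are only
  countably many such lists.\<close>

definition cut :: "bexp list \<Rightarrow> 'a \<Rightarrow> nat" where
  "cut c x = (LEAST n. length c \<le> n \<or> x \<in> bv (c ! n))"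

lemma cut_approx:
  assumes k[measurable]: "k \<in> measurable M (count_space UNIV)" and e: "e > 0"
  shows "\<exists>c. measure M {x \<in> space M. cut c x \<noteq> k x} < e"
proof -
  have "(\<lambda>n. measure M {x \<in> space M. n \<le> k x}) \<longlonglongrightarrow> measure M (\<Inter>n. {x \<in> space M. n \<le> k x})"
    by (rule finite_Lim_measure_decseq) (auto simp: decseq_def)
  also have "(\<Inter>n. {x \<in> space M. n \<le> k x}) = {}"
    using Suc_n_not_le_n by blast
  finally have "\<forall>\<^sub>F n in sequentially. dist (measure M {x \<in> space M. n \<le> k x}) 0 < e / 2"
    using e by (intro tendstoD) auto
  then obtain N where N: "measure M {x \<in> space M. N \<le> k x} < e / 2"
    by (auto simp: eventually_sequentially)
  define A where "A n = {x \<in> space M. k x = n}" for n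
  have Am[measurable]: "A n \<in> sets M" for n unfolding A_def by measurable
  \<comment> \<open>The N level sets share an error of e/2, the tail \<open>N \<le> k x\<close> has
    the other half; N + 1 in the denominator covers N = 0.\<close>
  have "e / (2 * (real N + 1)) > 0" using e by simp
  then have "\<exists>t. measure M (sym_diff (A n) (bv t)) < e / (2 * (real N + 1))" for n
    by (rule bval_approx[OF Am])
  then obtain t where t: "\<And>n. measure M (sym_diff (A n) (bv (t n))) < e / (2 * (real N + 1))"
    by metis
  let ?c = "map t [0..<N]"
  have "{x \<in> space M. cut ?c x \<noteq> k x} \<subseteq>
      {x \<in> space M. N \<le> k x} \<union> (\<Union>n<N. sym_diff (A n) (bv (t n)))"
  proof
    fix x assume x: "x \<in> {x \<in> space M. cut ?c x \<noteq> k x}"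
    show "x \<in> {x \<in> space M. N \<le> k x} \<union> (\<Union>n<N. sym_diff (A n) (bv (t n)))"
    proof (rule ccontr)
      assume n: "x \<notin> {x \<in> space M. N \<le> k x} \<union> (\<Union>n<N. sym_diff (A n) (bv (t n)))"
      have xsp: "x \<in> space M" using x by simp
      have kN: "k x < N" using n xsp by (simp add: not_le)
      have *: "x \<in> bv (t n) \<longleftrightarrow> k x = n" if "n < N" for n
      proof -
        have "x \<in> bv (t n) \<longleftrightarrow> x \<in> A n" using n that by blast
        then show ?thesis using xsp by (simp add: A_def)
      qed
      have "cut ?c x = k x" unfolding cut_def
      proof (rule Least_equality)
        show "length ?c \<le> k x \<or> x \<in> bv (?c ! k x)" using kN * by simp
        fix n assume n: "length ?c \<le> n \<or> x \<in> bv (?c ! n)"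
        show "k x \<le> n"
        proof (cases "n < N")
          case True
          then show ?thesis using n * by simp
        qed (use kN in simp)
      qed
      then show False using x by simp
    qed
  qed
  then have "measure M {x \<in> space M. cut ?c x \<noteq> k x} \<le>
      measure M ({x \<in> space M. N \<le> k x} \<union> (\<Union>n<N. sym_diff (A n) (bv (t n))))"
    by (rule finite_measure_mono) measurable
  also have "\<dots> \<le> measure M {x \<in> space M. N \<le> k x} + measure M (\<Union>n<N. sym_diff (A n) (bv (t n)))"
    by (rule measure_Un_le) measurable
  also have "measure M (\<Union>n<N. sym_diff (A n) (bv (t n))) \<le> (\<Sum>n<N. measure M (sym_diff (A n) (bv (t n))))"
    by (rule measure_UNION_le) auto
  also have "\<dots> \<le> (\<Sum>n<N. e / (2 * (real N + 1)))"
    by (rule sum_mono) (use t in \<open>auto intro: less_imp_le\<close>)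
  also have "\<dots> = (real N / (real N + 1)) * (e / 2)" by simp
  also have "\<dots> \<le> 1 * (e / 2)" using e by (intro mult_right_mono) auto
  finally show ?thesis using N by (intro exI[of _ ?c]) simp
qed

text \<open>An element of the full group is almost everywhere of the form \<open>f (k x) x\<close>,
  and \<open>k\<close> can be approximated by some \<open>cut c\<close>. The resulting centres
  \<open>g c\<close> need not be automorphisms, so the pieces are balls of radius e/2 around them,
  intersected with the full group.\<close>

lemma full_group_separable:
  assumes e: "e > 0"
  shows "\<exists>K :: nat \<Rightarrow> ('a \<Rightarrow> 'a) set. full_group M R = (\<Union>n. K n) \<and>
    (\<forall>n. \<forall>S\<in>K n. \<forall>T\<in>K n. measure M {x \<in> space M. S x \<noteq> T x} < e)"
proof -
  define g where "g c x = f (cut c x) x" for c x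
  have cutm[measurable]: "cut c \<in> measurable M (count_space UNIV)" for c
    unfolding cut_def by measurable
  have gm[measurable]: "g c \<in> measurable M M" for c
    unfolding g_def by (rule measurable_compose_countable[of "\<lambda>n. f n"]) measurable
  define K where "K n = {T \<in> full_group M R. measure M {x \<in> space M. T x \<noteq> g (from_nat n) x} < e / 2}" for n
  have Tm: "T \<in> measurable M M" if "T \<in> full_group M R" for T
    using that by (auto simp: full_group_def mp_automorphism_def)
  have "\<exists>n. T \<in> K n" if T: "T \<in> full_group M R" for T
  proof -
    note [measurable] = Tm[OF T]
    \<comment> \<open>Where \<open>(x, T x)\<close> is not in \<open>R\<close> the index may be a
      meaningless default; this happens on a null set only.\<close>
    define k where "k x = (LEAST n. T x = f n x)" for x
    have km[measurable]: "k \<in> measurable M (count_space UNIV)" unfolding k_def by measurable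
    obtain c where c: "measure M {x \<in> space M. cut c x \<noteq> k x} < e / 2"
      using cut_approx[OF km, of "e / 2"] e by auto
    have "AE x in M. (x, T x) \<in> R" using T by (simp add: full_group_def)
    then have AE: "AE x in M. x \<in> {x \<in> space M. T x \<noteq> g c x} \<longrightarrow> x \<in> {x \<in> space M. cut c x \<noteq> k x}"
    proof (rule AE_mp, intro AE_I2 impI)
      fix x assume x: "x \<in> space M" "(x, T x) \<in> R" "x \<in> {x \<in> space M. T x \<noteq> g c x}"
      have "T x = f (k x) x" unfolding k_def by (rule LeastI_ex[OF R_E[OF x(2)]])
      then show "x \<in> {x \<in> space M. cut c x \<noteq> k x}" using x by (auto simp: g_def)
    qed
    have "{x \<in> space M. cut c x \<noteq> k x} = {x \<in> space M. \<not> (\<exists>n. cut c x = n \<and> k x = n)}"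
      by auto
    moreover have "{x \<in> space M. \<not> (\<exists>n. cut c x = n \<and> k x = n)} \<in> sets M" by measurable
    ultimately have "{x \<in> space M. cut c x \<noteq> k x} \<in> sets M" by (simp only:)
    with AE have "measure M {x \<in> space M. T x \<noteq> g c x} \<le> measure M {x \<in> space M. cut c x \<noteq> k x}"
      by (rule finite_measure_mono_AE)
    then have "T \<in> K (to_nat c)" using c T by (simp add: K_def)
    then show ?thesis ..
  qed
  then have "full_group M R = (\<Union>n. K n)" by (auto simp: K_def)
  moreover have "measure M {x \<in> space M. S x \<noteq> T x} < e" if S: "S \<in> K n" and T: "T \<in> K n" for n S T
  proof -
    have [measurable]: "S \<in> measurable M M" "T \<in> measurable M M" using S T Tm by (auto simp: K_def)
    let ?g = "g (from_nat n)"
    have "measure M {x \<in> space M. S x \<noteq> T x} \<le>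
        measure M ({x \<in> space M. S x \<noteq> ?g x} \<union> {x \<in> space M. T x \<noteq> ?g x})"
      by (rule finite_measure_mono) auto
    also have "\<dots> \<le> measure M {x \<in> space M. S x \<noteq> ?g x} + measure M {x \<in> space M. T x \<noteq> ?g x}"
      by (rule measure_Un_le) measurable
    also have "\<dots> < e" using S T by (simp add: K_def)
    finally show ?thesis .
  qed
  ultimately show ?thesis by blast
qed

end

section \<open>Measure-preserving automorphisms and hyperfinite subrelations\<close>

lemma mp_automorphism_inv:
  assumes T: "mp_automorphism M T"
  shows "x \<in> space M \<Longrightarrow> inv_into (space M) T (T x) = x"
    and "x \<in> space M \<Longrightarrow> T (inv_into (space M) T x) = x"
    and "x \<in> space M \<Longrightarrow> inv_into (space M) T x \<in> space M"
    and "x \<in> space M \<Longrightarrow> T x \<in> space M"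
  using T unfolding mp_automorphism_def
  by (auto simp: bij_betw_def f_inv_into_f inv_into_into)

lemma mp_automorphism_image:
  assumes T: "mp_automorphism M T" and A: "A \<in> sets M"
  shows "T ` A \<in> sets M" and "emeasure M (T ` A) = emeasure M A"
proof -
  have Tm: "T \<in> measurable M M" "inv_into (space M) T \<in> measurable M M" "distr M M T = M"
    using T by (auto simp: mp_automorphism_def)
  have Asp: "A \<subseteq> space M" using sets.sets_into_space[OF A] .
  have "T ` A = inv_into (space M) T -` A \<inter> space M"
  proof (intro equalityI subsetI)
    fix y assume "y \<in> inv_into (space M) T -` A \<inter> space M"
    then have "inv_into (space M) T y \<in> A" "y = T (inv_into (space M) T y)"
      using mp_automorphism_inv(2)[OF T] by auto
    then show "y \<in> T ` A" by blast
  qed (use Asp mp_automorphism_inv[OF T] in auto)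
  then show TA: "T ` A \<in> sets M" using measurable_sets[OF Tm(2) A] by simp
  have "T -` (T ` A) \<inter> space M = A"
    using Asp mp_automorphism_inv(1)[OF T] by (auto, metis subsetD)
  then show "emeasure M (T ` A) = emeasure M A"
    using emeasure_distr[OF Tm(1) TA] Tm(3) by simp
qed

lemma mp_automorphism_image_pair:
  assumes T: "mp_automorphism M T" and A: "A \<in> sets (M \<Otimes>\<^sub>M M)"
  shows "map_prod T T ` A \<in> sets (M \<Otimes>\<^sub>M M)"
    and "x \<in> space M \<Longrightarrow> y \<in> space M \<Longrightarrow> (T x, T y) \<in> map_prod T T ` A \<longleftrightarrow> (x, y) \<in> A"
proof -
  let ?i = "inv_into (space M) T"
  have im[measurable]: "?i \<in> measurable M M" using T by (simp add: mp_automorphism_def)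
  have Asp: "A \<subseteq> space M \<times> space M" using sets.sets_into_space[OF A] by (simp add: space_pair_measure)
  have "map_prod T T ` A = (\<lambda>p. (?i (fst p), ?i (snd p))) -` A \<inter> space (M \<Otimes>\<^sub>M M)"
  proof (intro equalityI subsetI)
    fix p assume p: "p \<in> (\<lambda>p. (?i (fst p), ?i (snd p))) -` A \<inter> space (M \<Otimes>\<^sub>M M)"
    then have "p = map_prod T T (?i (fst p), ?i (snd p))"
      using mp_automorphism_inv(2)[OF T] by (auto simp: space_pair_measure)
    then show "p \<in> map_prod T T ` A" using p by blast
  qed (use Asp mp_automorphism_inv[OF T] in \<open>auto simp: space_pair_measure\<close>)
  also have "\<dots> \<in> sets (M \<Otimes>\<^sub>M M)"
    by (rule measurable_sets[OF _ A]) measurable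
  finally show "map_prod T T ` A \<in> sets (M \<Otimes>\<^sub>M M)" .
  show "(T x, T y) \<in> map_prod T T ` A \<longleftrightarrow> (x, y) \<in> A" if sp: "x \<in> space M" "y \<in> space M"
  proof
    assume "(T x, T y) \<in> map_prod T T ` A"
    then obtain u v where uv: "(u, v) \<in> A" "T x = T u" "T y = T v" by auto
    then have "u \<in> space M" "v \<in> space M" using Asp by auto
    then have "x = u" "y = v" using mp_automorphism_inv(1)[OF T] sp uv by metis+
    then show "(x, y) \<in> A" using uv by simp
  qed (auto intro: image_eqI[of _ _ "(x, y)"])
qed

text \<open>\<open>X\<close> may be smaller than the space because witnesses of hyperfiniteness live
  on a conull set. Injectivity of \<open>T\<close> gives transitivity of the image, and intersecting
  with the equivalence relation \<open>R\<close> preserves it.\<close>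

lemma mp_automorphism_image_equiv:
  assumes T: "mp_automorphism M T" and X: "X \<subseteq> space M" and eq: "equiv X A"
    and R: "equiv (space M) R"
  shows "equiv (T ` X) (map_prod T T ` A \<inter> R)"
proof -
  have AX: "A \<subseteq> X \<times> X" using equiv_type[OF eq] .
  have inj: "u = v" if "T u = T v" "u \<in> X" "v \<in> X" for u v
    using that X mp_automorphism_inv(1)[OF T] by (metis subsetD)
  show ?thesis
  proof (rule equivI)
    show "map_prod T T ` A \<inter> R \<subseteq> T ` X \<times> T ` X" using AX by auto
    show "refl_on (T ` X) (map_prod T T ` A \<inter> R)"
    proof (rule refl_onI)
      fix y assume "y \<in> T ` X"
      then obtain x where x: "x \<in> X" "y = T x" by auto
      then have "(x, x) \<in> A" "(y, y) \<in> R"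
        using eq R X mp_automorphism_inv(4)[OF T] by (auto simp: equiv_def refl_on_def)
      then show "(y, y) \<in> map_prod T T ` A \<inter> R" using x by (auto intro: image_eqI[of _ _ "(x, x)"])
    qed
    show "sym (map_prod T T ` A \<inter> R)"
    proof (rule symI)
      fix y z assume "(y, z) \<in> map_prod T T ` A \<inter> R"
      then obtain u v where uv: "(u, v) \<in> A" "y = T u" "z = T v" "(y, z) \<in> R" by auto
      then have "(v, u) \<in> A" "(z, y) \<in> R" using eq R unfolding equiv_def by (blast dest: symD)+
      then show "(z, y) \<in> map_prod T T ` A \<inter> R" using uv by (auto intro: image_eqI[of _ _ "(v, u)"])
    qed
    show "trans (map_prod T T ` A \<inter> R)"
    proof (rule transI)
      fix x y z assume 1: "(x, y) \<in> map_prod T T ` A \<inter> R" and 2: "(y, z) \<in> map_prod T T ` A \<inter> R"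
      obtain u v where uv: "(u, v) \<in> A" "x = T u" "y = T v" "(x, y) \<in> R" using 1 by auto
      obtain v' w where vw: "(v', w) \<in> A" "y = T v'" "z = T w" "(y, z) \<in> R" using 2 by auto
      have "v = v'" using inj uv vw AX by auto
      then have "(u, w) \<in> A" "(x, z) \<in> R"
        using eq R uv vw unfolding equiv_def by (blast dest: transD)+
      then show "(x, z) \<in> map_prod T T ` A \<inter> R" using uv vw by (auto intro: image_eqI[of _ _ "(u, w)"])
    qed
  qed
qed

section \<open>Countable data of a standard p.m.p. relation\<close>

text \<open>Numbers outside the carrier of the group are sent to its unit, so all natural numbers
  index group elements and \<open>\<iota>\<close> is inversion. A countable base of the Polish
  topology supplies the sets \<open>B n\<close>.\<close>

lemma standard_pmp_enum:
  assumes std: "standard_prob_space M" and pmp: "pmp_equiv_rel M R"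
  shows "\<exists>f \<iota> B. countable_pmp M R f \<iota> B"
proof -
  have prob: "prob_space M" and sb: "standard_borel M"
    using std by (auto simp: standard_prob_space_def)
  obtain G :: "nat monoid" and \<phi> where G: "group_action G (space M) \<phi>"
      "\<And>g. g \<in> carrier G \<Longrightarrow> \<phi> g \<in> measurable M M" "\<And>g. g \<in> carrier G \<Longrightarrow> distr M M (\<phi> g) = M"
      "R = {(x, y). x \<in> space M \<and> y \<in> Group_Action.orbit G \<phi> x}"
    using pmp unfolding pmp_equiv_rel_def by blast
  interpret A: group_action G "space M" \<phi> by fact
  interpret group G using G(1) by (simp add: group_action_def group_hom_def)
  define h where "h n = (if n \<in> carrier G then n else \<one>\<^bsub>G\<^esub>)" for n
  define f where "f n = \<phi> (h n)" for n
  define \<iota> where "\<iota> n = inv\<^bsub>G\<^esub> (h n)" for n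
  have h: "h n \<in> carrier G" for n by (simp add: h_def)
  have hi: "h (\<iota> n) = inv\<^bsub>G\<^esub> (h n)" for n using h by (simp add: h_def \<iota>_def)
  have fsp: "f n x \<in> space M" if "x \<in> space M" for n x
    using A.element_image[OF h that] by (simp add: f_def)
  have inv1: "f (\<iota> n) (f n x) = x" if "x \<in> space M" for x n
    unfolding f_def hi by (rule A.orbit_sym_aux[OF h that refl])
  have inv2: "f n (f (\<iota> n) x) = x" if "x \<in> space M" for x n
    using A.orbit_sym_aux[OF inv_closed[OF h[of n]] that refl] h by (simp add: f_def hi)
  have orb: "(y \<in> Group_Action.orbit G \<phi> x) = (\<exists>n. y = f n x)" for x y
    unfolding Group_Action.orbit_def f_def h_def by (auto split: if_splits)
  have Req: "R = {(x, y). x \<in> space M \<and> (\<exists>n. y = f n x)}" using G(4) orb by auto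
  have osp: "y \<in> space M" if "x \<in> space M" "y \<in> Group_Action.orbit G \<phi> x" for x y
    using that orb fsp by auto
  have Requiv: "equiv (space M) R"
  proof (rule equivI)
    show "R \<subseteq> space M \<times> space M" using G(4) osp by auto
    show "refl_on (space M) R" using G(4) osp A.orbit_refl by (auto simp: refl_on_def)
    show "sym R" using G(4) osp A.orbit_sym by (auto simp: sym_def)
    show "trans R"
    proof (rule transI)
      fix x y z assume "(x, y) \<in> R" "(y, z) \<in> R"
      then show "(x, z) \<in> R" using G(4) osp A.orbit_trans[of x y z] by auto
    qed
  qed
  obtain \<tau> where \<tau>: "completely_metrizable_space \<tau>" "second_countable \<tau>" "topspace \<tau> = space M"
      "sets M = sigma_sets (space M) {U. openin \<tau> U}"
    using sb unfolding standard_borel_def by blast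
  have H: "Hausdorff_space \<tau>"
    by (simp add: \<tau>(1) completely_metrizable_imp_metrizable_space metrizable_imp_Hausdorff_space)
  obtain \<B> where \<B>: "countable \<B>" "\<And>V. V \<in> \<B> \<Longrightarrow> openin \<tau> V"
      "\<And>U x. openin \<tau> U \<Longrightarrow> x \<in> U \<Longrightarrow> \<exists>V\<in>\<B>. x \<in> V \<and> V \<subseteq> U"
    using \<tau>(2) unfolding second_countable_def by metis
  \<comment> \<open>The empty set is added so that the family to be enumerated is certainly
    nonempty.\<close>
  define B where "B = from_nat_into (insert {} \<B>)"
  have rB: "range B = insert {} \<B>" unfolding B_def by (rule range_from_nat_into) (use \<B>(1) in auto)
  have Bopen: "openin \<tau> (B n)" for n
    using rB \<B>(2) by (metis insertE openin_empty rangeI)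
  have "U \<in> sigma_sets (space M) (range B)" if U: "openin \<tau> U" for U
  proof -
    have "U = \<Union>{V \<in> \<B>. V \<subseteq> U}" using \<B>(3)[OF U] by blast
    moreover have "\<Union>{V \<in> \<B>. V \<subseteq> U} \<in> sigma_sets (space M) (range B)"
      by (rule sigma_sets_UNION) (use \<B>(1) rB in \<open>auto intro: countable_subset\<close>)
    ultimately show ?thesis by simp
  qed
  then have "sigma_sets (space M) {U. openin \<tau> U} = sigma_sets (space M) (range B)"
    using Bopen by (intro sigma_sets_eqI) auto
  then have gen: "sets M = sigma_sets (space M) (range B)" using \<tau>(4) by simp
  have sep: "\<exists>n. x \<in> B n \<and> y \<notin> B n" if xy: "x \<in> space M" "y \<in> space M" "x \<noteq> y" for x y
  proof -
    obtain U V where UV: "openin \<tau> U" "openin \<tau> V" "x \<in> U" "y \<in> V" "disjnt U V"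
      using H xy \<tau>(3) unfolding Hausdorff_space_def by metis
    then obtain W where "W \<in> \<B>" "x \<in> W" "W \<subseteq> U" using \<B>(3) by blast
    moreover from this obtain n where "W = B n" using rB by (metis imageE insertCI)
    ultimately show ?thesis using UV by (auto simp: disjnt_iff)
  qed
  have "countable_pmp M R f \<iota> B"
  proof (intro countable_pmp.intro countable_pmp_axioms.intro)
    show "B n \<in> sets M" for n using gen by auto
  qed (use prob standard_borel_diagonal[OF sb] G(2,3) h inv1 inv2 Req Requiv sep gen in \<open>auto simp: f_def\<close>)
  then show ?thesis by blast
qed

section \<open>Neighbourhoods in the space of hyperfinite subrelations\<close>

text \<open>What is known of \<open>m\<close> is its finiteness, its sigma-algebra and its null
  sets. Smallness for \<open>m\<close> is therefore obtained from sets that decrease to the empty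
  set, and its effect on points from absolute continuity.\<close>

locale ergodic_pmp = countable_pmp M R f \<iota> B
  for M :: "'a measure" and R :: "('a \<times> 'a) set" and f :: "nat \<Rightarrow> 'a \<Rightarrow> 'a" and \<iota> B +
  fixes m :: "('a \<times> 'a) measure"
  assumes std: "standard_prob_space M" and pmp: "pmp_equiv_rel M R" and erg: "ergodic_rel M R"
    and m: "finite_equiv_measure (rel_measure M R) m"
begin

lemma sb: "standard_borel M" and atm: "atomless M"
  using std by (auto simp: standard_prob_space_def)

sublocale m: finite_measure m
  using m by (simp add: finite_equiv_measure_def)

lemma sets_m: "A \<in> sets m \<longleftrightarrow> A \<in> sets (M \<Otimes>\<^sub>M M) \<and> A \<subseteq> R"
  using m sets_rel_measure_iff[OF R_sets, of A] by (simp add: finite_equiv_measure_def)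

lemma null_m: "A \<in> null_sets m \<longleftrightarrow> A \<in> sets m \<and> (AE x in M. A `` {x} = {})"
  using m null_sets_rel_measure_iff[OF sb pmp, of A] by (auto simp: finite_equiv_measure_def)

text \<open>On the conull set \<open>X\<close> the finite relations \<open>F n\<close> increase to
  \<open>S\<close>, so what they miss decreases to the empty set and \<open>m\<close> is
  finite.\<close>

lemma hyperfinite_approx:
  assumes S: "S \<in> borel_subrels M R" "hyperfinite_rel M S" and e: "e > 0"
  shows "\<exists>F\<in>borel_subrels M R. (\<forall>x\<in>space M. finite (F `` {x})) \<and> measure m (sym_diff S F) < e"
proof -
  have Sm[measurable]: "S \<in> sets (M \<Otimes>\<^sub>M M)" and SR: "S \<subseteq> R" and Seq: "equiv (space M) S"
    using S(1) by (auto simp: borel_subrels_def)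
  obtain X F where X[measurable]: "X \<in> sets M" and X0: "emeasure M (space M - X) = 0"
    and F0: "\<And>n. F n \<in> sets (M \<Otimes>\<^sub>M M) \<and> equiv X (F n) \<and> (\<forall>x\<in>X. finite (F n `` {x})) \<and> F n \<subseteq> F (Suc n)"
    and SF: "S \<inter> X \<times> X = (\<Union>n::nat. F n)"
    using S(2) unfolding hyperfinite_rel_def by blast
  have Fm[measurable]: "F n \<in> sets (M \<Otimes>\<^sub>M M)" and Feq: "equiv X (F n)"
    and Ffin: "\<And>x. x \<in> X \<Longrightarrow> finite (F n `` {x})" and Finc: "F n \<subseteq> F (Suc n)" for n
    using F0 by blast+
  have Xsp: "X \<subseteq> space M" using sets.sets_into_space[OF X] .
  have FX: "F n \<subseteq> X \<times> X" for n using equiv_type[OF Feq] .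
  \<comment> \<open>Points outside \<open>X\<close> become singleton classes, which extends
    \<open>F n\<close> to an equivalence relation on the whole space.\<close>
  define Z where "Z n = {p \<in> space (M \<Otimes>\<^sub>M M). p \<in> F n \<or> fst p = snd p \<and> fst p \<notin> X}" for n
  have Z: "(x, y) \<in> Z n \<longleftrightarrow> (x, y) \<in> F n \<or> x \<in> space M - X \<and> y = x" for x y n
    using FX[of n] Xsp by (auto simp: Z_def space_pair_measure)
  have Zm[measurable]: "Z n \<in> sets (M \<Otimes>\<^sub>M M)" for n unfolding Z_def by measurable
  have Zeq: "equiv (space M) (Z n)" for n
  proof (rule equivI)
    have 1: "x \<in> X \<Longrightarrow> (x, x) \<in> F n" for x using Feq[of n] by (simp add: equiv_def refl_on_def)
    have 2: "(x, y) \<in> F n \<Longrightarrow> (y, x) \<in> F n" for x y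
      using Feq[of n] unfolding equiv_def by (blast dest: symD)
    have 3: "(x, y) \<in> F n \<Longrightarrow> (y, z) \<in> F n \<Longrightarrow> (x, z) \<in> F n" for x y z
      using Feq[of n] unfolding equiv_def by (blast dest: transD)
    show "Z n \<subseteq> space M \<times> space M" by (auto simp: Z_def space_pair_measure)
    show "refl_on (space M) (Z n)" using 1 by (auto simp: refl_on_def Z)
    show "sym (Z n)" using 2 by (auto simp: sym_def Z)
    show "trans (Z n)" using 3 FX[of n] unfolding trans_def Z by blast
  qed
  have ZS: "Z n \<subseteq> S" for n
  proof
    fix p assume p: "p \<in> Z n"
    obtain x y where xy: "p = (x, y)" by (cases p)
    show "p \<in> S" using p SF Seq unfolding xy Z by (auto simp: equiv_def refl_on_def)
  qed
  define W where "W n = S \<inter> X \<times> X - F n" for n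
  have Wm: "W n \<in> sets m" for n
    unfolding sets_m W_def using SR by auto
  have "(\<lambda>n. measure m (W n)) \<longlonglongrightarrow> measure m (\<Inter>n. W n)"
    using Wm Finc by (intro m.finite_Lim_measure_decseq decseq_SucI) (auto simp: W_def)
  also have "(\<Inter>n. W n) = {}" using SF by (auto simp: W_def)
  finally have "\<forall>\<^sub>F n in sequentially. dist (measure m (W n)) 0 < e"
    using e by (intro tendstoD) auto
  then obtain n where n: "measure m (W n) < e" by (auto simp: eventually_sequentially)
  \<comment> \<open>Such a pair has an endpoint outside \<open>X\<close>, so its first coordinate
    lies in the saturation of a null set; hence \<open>V\<close> is null.\<close>
  define V where "V = R - X \<times> X"
  have Vm: "V \<in> sets m" unfolding V_def sets_m by auto
  have V0: "V \<in> null_sets m"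
    unfolding null_m
  proof
    have "{x \<in> space M. \<exists>n. f n x \<in> space M - X} \<in> null_sets M"
      using X0 by (intro null_saturation) (auto simp: null_sets_def)
    then have 1: "AE x in M. x \<notin> {x \<in> space M. \<exists>n. f n x \<in> space M - X}" by (rule AE_not_in)
    have 2: "AE x in M. x \<notin> space M - X" by (rule AE_not_in) (use X0 in \<open>auto simp: null_sets_def\<close>)
    show "AE x in M. V `` {x} = {}"
      using 1 2
    proof eventually_elim
      case (elim x)
      then show ?case using R_E[of x] R_D[of x] by (auto simp: V_def)
    qed
  qed (rule Vm)
  have "measure m (sym_diff S (Z n)) \<le> measure m (W n \<union> V)"
  proof (rule m.finite_measure_mono)
    show "sym_diff S (Z n) \<subseteq> W n \<union> V"
      using ZS[of n] SR by (auto simp: W_def V_def Z)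
  qed (use Wm Vm in auto)
  also have "\<dots> = measure m (W n)" by (rule measure_Un_null_set[OF Wm V0])
  finally have "measure m (sym_diff S (Z n)) < e" using n by simp
  moreover have "Z n \<in> borel_subrels M R" using Zm Zeq ZS SR by (auto simp: borel_subrels_def)
  moreover have "finite (Z n `` {x})" if "x \<in> space M" for x
  proof (cases "x \<in> X")
    case True
    then have "Z n `` {x} = F n `` {x}" by (auto simp: Z)
    then show ?thesis using Ffin[OF True, of n] by simp
  next
    case False
    then have "Z n `` {x} \<subseteq> {x}" using FX[of n] unfolding Image_def Z by blast
    then show ?thesis by (rule finite_subset) simp
  qed
  ultimately show ?thesis by blast
qed

lemma finite_hyperfinite:
  assumes "S \<in> borel_subrels M R" "\<And>x. x \<in> space M \<Longrightarrow> finite (S `` {x})"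
  shows "hyperfinite_rel M S"
  unfolding hyperfinite_rel_def
proof (intro bexI conjI exI[of _ "\<lambda>_. S"])
  show "S \<inter> space M \<times> space M = (\<Union>n::nat. S)"
    using assms(1) by (auto simp: borel_subrels_def dest: equiv_type)
qed (use assms in \<open>auto simp: borel_subrels_def\<close>)

text \<open>The pairs of \<open>R\<close> outside the graphs of the first n maps decrease to the
  empty set as n grows. Once they have \<open>m\<close>-measure below \<open>e\<close>, all pairs
  added by an extension that avoids these maps do too.\<close>

lemma spread_extension_near:
  assumes S: "S \<in> borel_subrels M R" and fin: "\<forall>x\<in>space M. finite (S `` {x})" and e: "e > 0"
  shows "\<exists>S'\<in>borel_subrels M R. (\<forall>x\<in>space M. finite (S' `` {x})) \<and> measure m (sym_diff S S') < e \<and>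
    (\<exists>P\<in>sets M. \<exists>\<theta>\<in>measurable M M. space M - P \<in> null_sets M \<and> inj_on \<theta> P \<and>
      (\<forall>x\<in>P. (x, \<theta> x) \<in> S' - S))"
proof -
  have Sm: "S \<in> sets (M \<Otimes>\<^sub>M M)" "equiv (space M) S" "S \<subseteq> R"
    using S by (auto simp: borel_subrels_def)
  define W where "W n = {p \<in> space (M \<Otimes>\<^sub>M M). p \<in> R \<and> (\<forall>j<n. snd p \<noteq> f j (fst p))}" for n
  have Wm: "W n \<in> sets m" for n
  proof -
    have "W n \<in> sets (M \<Otimes>\<^sub>M M)" unfolding W_def by measurable
    then show ?thesis by (auto simp: sets_m W_def)
  qed
  have "(\<lambda>n. measure m (W n)) \<longlonglongrightarrow> measure m (\<Inter>n. W n)"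
    using Wm by (intro m.finite_Lim_measure_decseq decseq_SucI) (auto simp: W_def)
  also have "(\<Inter>n. W n) = {}"
  proof (rule equals0I)
    fix p assume p: "p \<in> (\<Inter>n. W n)"
    then have "p \<in> R" by (auto simp: W_def)
    then obtain n where "snd p = f n (fst p)" using R_E[of "fst p" "snd p"] by auto
    moreover have "p \<in> W (Suc n)" using p by blast
    ultimately show False by (auto simp: W_def)
  qed
  finally have "\<forall>\<^sub>F n in sequentially. dist (measure m (W n)) 0 < e"
    using e by (intro tendstoD) auto
  then obtain n where n: "measure m (W n) < e" by (auto simp: eventually_sequentially)
  obtain S' where S': "S' \<in> sets (M \<Otimes>\<^sub>M M)" "equiv (space M) S'" "S' \<subseteq> R" "S \<subseteq> S'"
      "\<forall>x\<in>space M. finite (S' `` {x})" "\<forall>x\<in>space M. \<forall>j<n. (x, f j x) \<in> S' \<longrightarrow> (x, f j x) \<in> S"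
      "\<exists>P\<in>sets M. \<exists>\<theta>\<in>measurable M M. space M - P \<in> null_sets M \<and> inj_on \<theta> P \<and>
        (\<forall>x\<in>P. (x, \<theta> x) \<in> S' - S)"
    by (rule bexE[OF spread_extension[where N = n, OF erg atm Sm fin]], elim conjE, rule that)
  have "sym_diff S S' \<subseteq> W n"
  proof
    fix p assume "p \<in> sym_diff S S'"
    then have p: "p \<in> S'" "p \<notin> S" using S'(4) by auto
    then have "p \<in> R" using S'(3) by auto
    then have "fst p \<in> space M" "p \<in> space (M \<Otimes>\<^sub>M M)"
      using R_D[of "fst p" "snd p"] by (auto simp: space_pair_measure mem_Times_iff)
    moreover have "snd p \<noteq> f j (fst p)" if "j < n" for j
      using S'(6) p that \<open>fst p \<in> space M\<close> by (metis prod.collapse)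
    ultimately show "p \<in> W n" using \<open>p \<in> R\<close> by (auto simp: W_def)
  qed
  then have "measure m (sym_diff S S') \<le> measure m (W n)"
    by (rule m.finite_measure_mono[OF _ Wm])
  then have "measure m (sym_diff S S') < e" using n by simp
  moreover have "S' \<in> borel_subrels M R" using S' by (simp add: borel_subrels_def)
  ultimately show ?thesis using S'(5,7) by blast
qed

section \<open>The orbit and the separation of its pieces\<close>

text \<open>This places the orbit inside the space in which it is to be meager. The witnesses
  \<open>X\<close> and \<open>F n\<close> of hyperfiniteness are transported by \<open>T\<close> and
  intersected with \<open>R\<close>, as the action prescribes.\<close>

lemma full_group_image:
  assumes T: "T \<in> full_group M R" and S: "S \<in> borel_subrels M R" "hyperfinite_rel M S"
  shows "map_prod T T ` S \<inter> R \<in> borel_subrels M R" "hyperfinite_rel M (map_prod T T ` S \<inter> R)"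
proof -
  have mp: "mp_automorphism M T" using T by (simp add: full_group_def)
  have TX: "T ` space M = space M" using mp by (simp add: mp_automorphism_def bij_betw_def)
  have Sm: "S \<in> sets (M \<Otimes>\<^sub>M M)" and SR: "S \<subseteq> R" and Seq: "equiv (space M) S"
    using S(1) by (auto simp: borel_subrels_def)
  show "map_prod T T ` S \<inter> R \<in> borel_subrels M R"
    using mp_automorphism_image_pair(1)[OF mp Sm] R_sets
      mp_automorphism_image_equiv[OF mp order_refl Seq R_equiv]
    by (simp add: borel_subrels_def TX)
  obtain X F where X: "X \<in> sets M" and X0: "emeasure M (space M - X) = 0"
    and F: "\<And>n. F n \<in> sets (M \<Otimes>\<^sub>M M) \<and> equiv X (F n) \<and> (\<forall>x\<in>X. finite (F n `` {x})) \<and> F n \<subseteq> F (Suc n)"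
    and SF: "S \<inter> X \<times> X = (\<Union>n::nat. F n)"
    using S(2) unfolding hyperfinite_rel_def by blast
  have Xsp: "X \<subseteq> space M" using sets.sets_into_space[OF X] .
  have inj: "u = v" if "T u = T v" "u \<in> space M" "v \<in> space M" for u v
    using that mp_automorphism_inv(1)[OF mp] by metis
  have "T ` X \<in> sets M" by (rule mp_automorphism_image(1)[OF mp X])
  moreover have "emeasure M (space M - T ` X) = 0"
  proof -
    have "T ` (space M - X) = T ` space M - T ` X"
      by (rule inj_on_image_set_diff[of T "space M"]) (use inj Xsp in \<open>auto simp: inj_on_def\<close>)
    then have "space M - T ` X = T ` (space M - X)" by (simp only: TX)
    then show ?thesis using mp_automorphism_image(2)[OF mp, of "space M - X"] X X0 by simp
  qed
  moreover have "map_prod T T ` F n \<inter> R \<in> sets (M \<Otimes>\<^sub>M M)" for n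
    using mp_automorphism_image_pair(1)[OF mp] F R_sets by blast
  moreover have "equiv (T ` X) (map_prod T T ` F n \<inter> R)" for n
    using mp_automorphism_image_equiv[OF mp Xsp _ R_equiv] F by blast
  moreover have "finite ((map_prod T T ` F n \<inter> R) `` {y})" if y: "y \<in> T ` X" for y n
  proof -
    obtain x where x: "x \<in> X" "y = T x" using y by auto
    have "(map_prod T T ` F n \<inter> R) `` {y} \<subseteq> T ` (F n `` {x})"
    proof
      fix z assume "z \<in> (map_prod T T ` F n \<inter> R) `` {y}"
      then obtain u v where uv: "(u, v) \<in> F n" "T x = T u" "z = T v" using x by auto
      moreover have "u \<in> X" using uv F equiv_type by blast
      ultimately have "u = x" using inj[of x u] x Xsp by auto
      then show "z \<in> T ` (F n `` {x})" using uv by auto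
    qed
    then show ?thesis using F x by (meson finite_imageI finite_subset)
  qed
  moreover have "map_prod T T ` F n \<inter> R \<subseteq> map_prod T T ` F (Suc n) \<inter> R" for n
    using F by blast
  moreover have "map_prod T T ` S \<inter> R \<inter> T ` X \<times> T ` X = (\<Union>n. map_prod T T ` F n \<inter> R)"
  proof -
    have "map_prod T T ` S \<inter> T ` X \<times> T ` X = map_prod T T ` (S \<inter> X \<times> X)"
    proof (intro equalityI subsetI)
      fix p assume "p \<in> map_prod T T ` S \<inter> T ` X \<times> T ` X"
      then obtain u v x y where *: "(u, v) \<in> S" "p = (T u, T v)" "x \<in> X" "y \<in> X" "T x = T u" "T y = T v"
        by auto
      moreover have "u \<in> space M" "v \<in> space M" using * SR R_D by blast+
      ultimately have "x = u" "y = v" using inj[of x u] inj[of y v] Xsp by auto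
      then show "p \<in> map_prod T T ` (S \<inter> X \<times> X)" using * by (auto intro: image_eqI[of _ _ "(u, v)"])
    qed auto
    then have "map_prod T T ` S \<inter> T ` X \<times> T ` X = (\<Union>n. map_prod T T ` F n)"
      unfolding SF by (simp only: image_UN)
    moreover have "map_prod T T ` S \<inter> R \<inter> T ` X \<times> T ` X = (map_prod T T ` S \<inter> T ` X \<times> T ` X) \<inter> R"
      by (simp only: Int_ac)
    ultimately show ?thesis by (simp only: UN_simps)
  qed
  ultimately show "hyperfinite_rel M (map_prod T T ` S \<inter> R)"
    unfolding hyperfinite_rel_def
    by (intro bexI[of _ "T ` X"] conjI exI[of _ "\<lambda>n. map_prod T T ` F n \<inter> R"] allI ballI) simp_all
qed

text \<open>If \<open>S\<^sub>1\<close> and \<open>S\<^sub>2\<close> are images of one relation under maps that agree on \<open>Q\<close>, they coincide on a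
  translate \<open>A\<close> of \<open>Q\<close>; so whenever \<open>(x, \<theta> x)\<close> separates \<open>S\<^sub>1\<close> from \<open>S\<^sub>2\<close>, one of \<open>x\<close>, \<open>\<theta> x\<close>
  is outside of \<open>A\<close>.\<close>

lemma full_group_images_separated:
  assumes F: "F \<in> borel_subrels M R" and S': "S' \<in> borel_subrels M R"
    and P: "P \<in> sets M" and \<theta>: "\<theta> \<in> measurable M M" and Pnull: "space M - P \<in> null_sets M"
    and inj: "inj_on \<theta> P" and sep: "\<forall>x\<in>P. (x, \<theta> x) \<in> S' - F"
  shows "\<exists>\<rho>>0. \<forall>S\<in>borel_subrels M R. \<forall>T\<^sub>1\<in>full_group M R. \<forall>T\<^sub>2\<in>full_group M R.
    measure M {x \<in> space M. T\<^sub>1 x \<noteq> T\<^sub>2 x} < 1/4 \<longrightarrow>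
    measure m (sym_diff F (map_prod T\<^sub>1 T\<^sub>1 ` S \<inter> R)) < \<rho> \<longrightarrow>
    measure m (sym_diff S' (map_prod T\<^sub>2 T\<^sub>2 ` S \<inter> R)) < \<rho> \<longrightarrow> False"
proof -
  note [measurable] = P \<theta>
  have Psp: "P \<subseteq> space M" using sets.sets_into_space[OF P] .
  have sm: "F \<in> sets m" "S' \<in> sets m" "S' \<subseteq> R" using F S' by (auto simp: borel_subrels_def sets_m)
  \<comment> \<open>The diagonal value off \<open>P\<close> only serves to make \<open>h\<close> a
    total map into \<open>R\<close>.\<close>
  define h where "h x = (x, if x \<in> P then \<theta> x else x)" for x
  have hR: "h x \<in> R" if "x \<in> space M" for x
    using that sep sm(3) R_equiv by (auto simp: h_def equiv_def refl_on_def)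
  have setsm: "sets m = sets (restrict_space (M \<Otimes>\<^sub>M M) R)"
    using m sets_rel_measure[OF R_sets] by (simp add: finite_equiv_measure_def)
  have hm: "h \<in> measurable M m"
  proof -
    have "h \<in> measurable M (M \<Otimes>\<^sub>M M)" unfolding h_def by measurable
    then have "h \<in> measurable M (restrict_space (M \<Otimes>\<^sub>M M) R)"
      using hR by (intro measurable_restrict_space2) auto
    then show ?thesis using measurable_cong_sets[OF refl setsm, of M] by blast
  qed
  \<comment> \<open>This image measure assigns to a subset of \<open>R\<close> the measure of the
    points x whose test pair \<open>h x\<close> lies in it. It is absolutely continuous for
    \<open>m\<close>: a null subset of \<open>R\<close> has empty sections over almost every
    x.\<close>
  define \<nu> where "\<nu> = distr M m h"
  have \<nu>: "measure \<nu> A = measure M {x \<in> space M. h x \<in> A}" if "A \<in> sets m" for A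
    using measure_distr[OF hm that] by (simp add: \<nu>_def vimage_def Int_def conj_commute)
  have "finite_measure \<nu>" unfolding \<nu>_def by (rule finite_measure_distr[OF hm])
  moreover have "null_sets m \<subseteq> null_sets \<nu>"
  proof
    fix A assume A: "A \<in> null_sets m"
    then have Am: "A \<in> sets m" and A0: "AE x in M. A `` {x} = {}" by (auto simp: null_m)
    have "AE x in M. x \<notin> {x \<in> space M. h x \<in> A}"
      using A0 by eventually_elim (auto simp: h_def)
    moreover have "{x \<in> space M. h x \<in> A} = h -` A \<inter> space M" by auto
    then have "{x \<in> space M. h x \<in> A} \<in> sets M" using measurable_sets[OF hm Am] by simp
    ultimately have "{x \<in> space M. h x \<in> A} \<in> null_sets M" by (simp add: AE_iff_null_sets)
    then show "A \<in> null_sets \<nu>"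
      using Am emeasure_distr[OF hm Am] \<open>{x \<in> space M. h x \<in> A} = h -` A \<inter> space M\<close>
      by (simp add: \<nu>_def null_sets_def)
  qed
  moreover have "sets \<nu> = sets m" by (simp add: \<nu>_def)
  ultimately have "\<exists>\<rho>>0. \<forall>A\<in>sets m. measure m A < \<rho> \<longrightarrow> measure \<nu> A < 1/4"
    by (intro absolutely_continuous_eps_delta m.finite_measure_axioms) simp_all
  then obtain \<rho> where \<rho>: "\<rho> > 0" "\<And>A. A \<in> sets m \<Longrightarrow> measure m A < \<rho> \<Longrightarrow> measure \<nu> A < 1/4" by blast
  have False if S: "S \<in> borel_subrels M R" and T\<^sub>1: "T\<^sub>1 \<in> full_group M R" and T\<^sub>2: "T\<^sub>2 \<in> full_group M R"
    and T12: "measure M {x \<in> space M. T\<^sub>1 x \<noteq> T\<^sub>2 x} < 1/4"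
    and 1: "measure m (sym_diff F (map_prod T\<^sub>1 T\<^sub>1 ` S \<inter> R)) < \<rho>"
    and 2: "measure m (sym_diff S' (map_prod T\<^sub>2 T\<^sub>2 ` S \<inter> R)) < \<rho>" for S T\<^sub>1 T\<^sub>2
  proof -
    have mp: "mp_automorphism M T\<^sub>1" "mp_automorphism M T\<^sub>2" using T\<^sub>1 T\<^sub>2 by (auto simp: full_group_def)
    then have [measurable]: "T\<^sub>1 \<in> measurable M M" "T\<^sub>2 \<in> measurable M M" by (auto simp: mp_automorphism_def)
    have Sm: "S \<in> sets (M \<Otimes>\<^sub>M M)" using S by (simp add: borel_subrels_def)
    let ?S1 = "map_prod T\<^sub>1 T\<^sub>1 ` S" and ?S2 = "map_prod T\<^sub>2 T\<^sub>2 ` S"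
    have S12: "?S1 \<inter> R \<in> sets m" "?S2 \<inter> R \<in> sets m"
      using mp_automorphism_image_pair(1)[OF mp(1) Sm] mp_automorphism_image_pair(1)[OF mp(2) Sm]
      by (auto simp: sets_m)
    let ?D1 = "sym_diff F (?S1 \<inter> R)" and ?D2 = "sym_diff S' (?S2 \<inter> R)"
    have Dm: "?D1 \<in> sets m" "?D2 \<in> sets m" using S12 sm by auto
    define B1 where "B1 = {x \<in> space M. h x \<in> ?D1}"
    define B2 where "B2 = {x \<in> space M. h x \<in> ?D2}"
    have Bm: "B1 \<in> sets M" "B2 \<in> sets M"
      using measurable_sets[OF hm Dm(1)] measurable_sets[OF hm Dm(2)]
      by (simp_all only: B1_def B2_def vimage_def Int_def mem_Collect_eq conj_commute)
    have B: "measure M B1 < 1/4" "measure M B2 < 1/4"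
      using \<rho>(2)[OF Dm(1) 1] \<rho>(2)[OF Dm(2) 2] by (simp_all only: \<nu>[OF Dm(1)] \<nu>[OF Dm(2)] B1_def B2_def)
    define Q where "Q = {x \<in> space M. T\<^sub>1 x = T\<^sub>2 x}"
    have Qm[measurable]: "Q \<in> sets M" unfolding Q_def by measurable
    \<comment> \<open>Both maps agree on \<open>Q\<close>, so \<open>A\<close> is its image under
      either, and on \<open>A\<close> both images of \<open>S\<close> pull back to the same pairs of
      \<open>Q\<close>. Measure preservation keeps the complement of \<open>A\<close> below
      1/4.\<close>
    define A where "A = T\<^sub>1 ` Q"
    have Am[measurable]: "A \<in> sets M" unfolding A_def by (rule mp_automorphism_image(1)[OF mp(1) Qm])
    have "measure M A = measure M Q"
      using mp_automorphism_image(2)[OF mp(1) Qm] by (simp add: A_def measure_def)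
    then have "measure M (space M - A) = measure M (space M - Q)"
      by (simp add: prob_compl)
    also have "space M - Q = {x \<in> space M. T\<^sub>1 x \<noteq> T\<^sub>2 x}" by (auto simp: Q_def)
    finally have A4: "measure M (space M - A) < 1/4" using T12 by simp
    have AS: "(x, y) \<in> ?S1 \<longleftrightarrow> (x, y) \<in> ?S2" if xy: "x \<in> A" "y \<in> A" for x y
    proof -
      obtain u v where uv: "u \<in> Q" "v \<in> Q" "x = T\<^sub>1 u" "y = T\<^sub>1 v" using xy by (auto simp: A_def)
      then have "x = T\<^sub>2 u" "y = T\<^sub>2 v" "u \<in> space M" "v \<in> space M" by (auto simp: Q_def)
      then show ?thesis
        using mp_automorphism_image_pair(2)[OF mp(1) Sm, of u v]
          mp_automorphism_image_pair(2)[OF mp(2) Sm, of u v] uv by simp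
    qed
    define C where "C = {x \<in> P. \<theta> x \<in> space M - A}"
    have Cm: "C \<in> sets M"
    proof -
      have "C = {x \<in> space M. x \<in> P \<and> \<theta> x \<in> space M - A}" using Psp by (auto simp: C_def)
      also have "\<dots> \<in> sets M" by measurable
      finally show ?thesis .
    qed
    \<comment> \<open>Injectivity of \<open>\<theta>\<close> and its graph lying in \<open>R\<close>
      are used here: pulling the complement of \<open>A\<close> back along \<open>\<theta>\<close>
      does not increase its measure.\<close>
    have "emeasure M C \<le> emeasure M (space M - A)"
      unfolding C_def by (rule emeasure_inj_le[OF P _ \<theta> inj]) (use sep sm(3) in auto)
    then have C4: "measure M C < 1/4" using A4 by (simp add: emeasure_eq_measure)
    have "space M \<subseteq> (space M - P) \<union> (B1 \<union> B2) \<union> ((space M - A) \<union> C)"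
    proof
      fix x assume x: "x \<in> space M"
      show "x \<in> (space M - P) \<union> (B1 \<union> B2) \<union> ((space M - A) \<union> C)"
      proof (rule ccontr)
        assume n: "x \<notin> (space M - P) \<union> (B1 \<union> B2) \<union> ((space M - A) \<union> C)"
        then have xP: "x \<in> P" and xA: "x \<in> A" using x by auto
        have hx: "h x = (x, \<theta> x)" using xP by (simp add: h_def)
        have \<theta>A: "\<theta> x \<in> A" using n xP x measurable_space[OF \<theta> x] by (auto simp: C_def)
        have "x \<notin> B1" "x \<notin> B2" using n by blast+
        then have "(x, \<theta> x) \<notin> ?D1" "(x, \<theta> x) \<notin> ?D2"
          using x hx by (simp_all only: B1_def B2_def mem_Collect_eq simp_thms)
        moreover have "(x, \<theta> x) \<in> S'" "(x, \<theta> x) \<notin> F" "(x, \<theta> x) \<in> R" using sep xP sm(3) by auto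
        ultimately have "(x, \<theta> x) \<notin> ?S1" "(x, \<theta> x) \<in> ?S2"
          by (simp_all only: Un_iff Diff_iff Int_iff simp_thms)
        then show False using AS[OF xA \<theta>A] by simp
      qed
    qed
    then have "1 \<le> measure M ((space M - P) \<union> (B1 \<union> B2) \<union> ((space M - A) \<union> C))"
      using Bm Cm by (subst prob_space[symmetric]) (intro finite_measure_mono; auto)
    also have "\<dots> \<le> measure M ((space M - P) \<union> (B1 \<union> B2)) + measure M ((space M - A) \<union> C)"
      using Bm Cm by (intro measure_Un_le) auto
    also have "\<dots> \<le> (measure M (space M - P) + measure M (B1 \<union> B2)) + (measure M (space M - A) + measure M C)"
      using Bm Cm by (intro add_mono measure_Un_le) auto
    also have "measure M (B1 \<union> B2) \<le> measure M B1 + measure M B2"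
      using Bm by (intro measure_Un_le) auto
    also have "measure M (space M - P) = 0" using Pnull by (simp add: measure_eq_0_null_sets)
    finally show False using B A4 C4 by linarith
  qed
  then show ?thesis using \<rho>(1) by blast
qed

text \<open>\<open>F\<close> and \<open>S'\<close> are the two test points of the metric criterion.
  Hyperfiniteness puts \<open>F\<close> within e/2 of the given class and \<open>S'\<close> lies
  within e/2 of \<open>F\<close>; both have finite classes and so stay in the space. The bound 1/4
  makes the separation apply to any two members of the piece.\<close>

lemma nowhere_dense_piece:
  assumes S: "S \<in> borel_subrels M R" "hyperfinite_rel M S" and K: "K \<subseteq> full_group M R"
    and close: "\<And>T\<^sub>1 T\<^sub>2. T\<^sub>1 \<in> K \<Longrightarrow> T\<^sub>2 \<in> K \<Longrightarrow> measure M {x \<in> space M. T\<^sub>1 x \<noteq> T\<^sub>2 x} < 1/4"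
  shows "nowhere_dense_in (Sub_hyp_topology M R m)
    ((\<lambda>T. full_group_act M R T (ae_class (rel_measure M R) S)) ` K)"
proof -
  let ?N = "rel_measure M R"
  interpret MS: Metric_space "MAlg ?N" "MAlg_dist m" by (rule Metric_space_MAlg[OF m])
  have setsN: "A \<in> sets ?N" if "A \<in> borel_subrels M R" for A
    using that by (simp add: borel_subrels_def sets_rel_measure_iff[OF R_sets])
  have act: "full_group_act M R T (ae_class ?N S) = ae_class ?N (map_prod T T ` S \<inter> R)"
    if "T \<in> K" for T
    using that K full_group_act_class[OF sb pmp _ setsN[OF S(1)]] by (auto simp: full_group_def)
  have dist: "MAlg_dist m (ae_class ?N A) (ae_class ?N A') = measure m (sym_diff A A')"
    if "A \<in> borel_subrels M R" "A' \<in> borel_subrels M R" for A A'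
    by (rule MAlg_dist_class[OF m setsN[OF that(1)] setsN[OF that(2)]])
  have Kim: "map_prod T T ` S \<inter> R \<in> borel_subrels M R" "hyperfinite_rel M (map_prod T T ` S \<inter> R)"
    if "T \<in> K" for T
    using full_group_image[OF _ S] that K by blast+
  show ?thesis
    unfolding Sub_hyp_topology_def MAlg_topology_def
  proof (rule MS.nowhere_dense_in_subtopologyI)
    show "Sub_hyp M R \<subseteq> MAlg ?N"
      using setsN by (auto simp: Sub_hyp_def MAlg_def intro: quotientI)
    show "(\<lambda>T. full_group_act M R T (ae_class ?N S)) ` K \<subseteq> Sub_hyp M R"
      using act Kim by (auto simp: Sub_hyp_def)
    fix y and e :: real assume y: "y \<in> Sub_hyp M R" and e: "e > 0"
    obtain Y where Y: "Y \<in> borel_subrels M R" "hyperfinite_rel M Y" "y = ae_class ?N Y"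
      using y by (auto simp: Sub_hyp_def)
    obtain F where F: "F \<in> borel_subrels M R" "\<forall>x\<in>space M. finite (F `` {x})"
      and YF: "measure m (sym_diff Y F) < e / 2"
      using hyperfinite_approx[OF Y(1,2), of "e / 2"] e by auto
    obtain S' where S': "S' \<in> borel_subrels M R" "\<forall>x\<in>space M. finite (S' `` {x})"
      and FS': "measure m (sym_diff F S') < e / 2"
      and ex: "\<exists>P\<in>sets M. \<exists>\<theta>\<in>measurable M M. space M - P \<in> null_sets M \<and> inj_on \<theta> P \<and>
        (\<forall>x\<in>P. (x, \<theta> x) \<in> S' - F)"
      using spread_extension_near[OF F, of "e / 2"] e by auto
    obtain P \<theta> where P\<theta>: "P \<in> sets M" "\<theta> \<in> measurable M M" "space M - P \<in> null_sets M"
      "inj_on \<theta> P" "\<forall>x\<in>P. (x, \<theta> x) \<in> S' - F"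
      using ex by blast
    obtain \<rho> where \<rho>: "\<rho> > 0" and sep: "\<And>S T\<^sub>1 T\<^sub>2. S \<in> borel_subrels M R \<Longrightarrow> T\<^sub>1 \<in> full_group M R \<Longrightarrow>
        T\<^sub>2 \<in> full_group M R \<Longrightarrow> measure M {x \<in> space M. T\<^sub>1 x \<noteq> T\<^sub>2 x} < 1/4 \<Longrightarrow>
        measure m (sym_diff F (map_prod T\<^sub>1 T\<^sub>1 ` S \<inter> R)) < \<rho> \<Longrightarrow>
        measure m (sym_diff S' (map_prod T\<^sub>2 T\<^sub>2 ` S \<inter> R)) < \<rho> \<Longrightarrow> False"
      using full_group_images_separated[OF F(1) S'(1) P\<theta>] by blast
    let ?F = "ae_class ?N F" and ?S' = "ae_class ?N S'"
    have mem: "?F \<in> Sub_hyp M R" "?S' \<in> Sub_hyp M R"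
      using F S' finite_hyperfinite by (auto simp: Sub_hyp_def)
    have dF: "MAlg_dist m y ?F < e / 2" using YF dist[OF Y(1) F(1)] Y(3) by simp
    have "MAlg_dist m y ?S' \<le> MAlg_dist m y ?F + MAlg_dist m ?F ?S'"
      using \<open>Sub_hyp M R \<subseteq> MAlg ?N\<close> mem y by (intro MS.triangle) auto
    then have dS': "MAlg_dist m y ?S' < e" using dF FS' dist[OF F(1) S'(1)] by simp
    have "False" if "T\<^sub>1 \<in> K" "T\<^sub>2 \<in> K"
      "MAlg_dist m ?F (full_group_act M R T\<^sub>1 (ae_class ?N S)) < \<rho>"
      "MAlg_dist m ?S' (full_group_act M R T\<^sub>2 (ae_class ?N S)) < \<rho>" for T\<^sub>1 T\<^sub>2
    proof (rule sep[OF S(1)])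
      show "T\<^sub>1 \<in> full_group M R" "T\<^sub>2 \<in> full_group M R" using that K by auto
      show "measure M {x \<in> space M. T\<^sub>1 x \<noteq> T\<^sub>2 x} < 1/4" using that close by simp
      show "measure m (sym_diff F (map_prod T\<^sub>1 T\<^sub>1 ` S \<inter> R)) < \<rho>"
        using that(3) act[OF that(1)] dist[OF F(1) Kim(1)[OF that(1)]] by simp
      show "measure m (sym_diff S' (map_prod T\<^sub>2 T\<^sub>2 ` S \<inter> R)) < \<rho>"
        using that(4) act[OF that(2)] dist[OF S'(1) Kim(1)[OF that(2)]] by simp
    qed
    then show "\<exists>u\<in>Sub_hyp M R. \<exists>v\<in>Sub_hyp M R. \<exists>\<rho>>0. MAlg_dist m y u < e \<and> MAlg_dist m y v < e \<and>
      (\<forall>a\<in>(\<lambda>T. full_group_act M R T (ae_class ?N S)) ` K.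
        \<forall>b\<in>(\<lambda>T. full_group_act M R T (ae_class ?N S)) ` K.
          MAlg_dist m u a < \<rho> \<longrightarrow> MAlg_dist m v b < \<rho> \<longrightarrow> False)"
      using dF dS' e \<rho> by (intro bexI[OF _ mem(1)] bexI[OF _ mem(2)] exI[of _ \<rho>]) auto
  qed
qed

end

theorem theorem4p16:
  fixes M :: "'a measure" and R :: "('a \<times> 'a) set" and m :: "('a \<times> 'a) measure"
  assumes "standard_prob_space M"
    and "pmp_equiv_rel M R"
    and "ergodic_rel M R"
    and "finite_equiv_measure (rel_measure M R) m"
    and "C \<in> Sub_hyp M R"
  shows "meager_in (Sub_hyp_topology M R m) (full_group_orbit M R C)"
proof -
  obtain f \<iota> B where "countable_pmp M R f \<iota> B" using standard_pmp_enum[OF assms(1,2)] by blast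
  then interpret ergodic_pmp M R f \<iota> B m
    using assms by (simp add: ergodic_pmp_def ergodic_pmp_axioms_def)
  obtain S where S: "S \<in> borel_subrels M R" "hyperfinite_rel M S" and C: "C = ae_class (rel_measure M R) S"
    using assms(5) by (auto simp: Sub_hyp_def)
  obtain K :: "nat \<Rightarrow> ('a \<Rightarrow> 'a) set" where K: "full_group M R = (\<Union>n. K n)"
    and close: "\<forall>n. \<forall>S\<in>K n. \<forall>T\<in>K n. measure M {x \<in> space M. S x \<noteq> T x} < 1/4"
    using full_group_separable[of "1/4"] by auto
  have "nowhere_dense_in (Sub_hyp_topology M R m) ((\<lambda>T. full_group_act M R T C) ` K n)" for n
    unfolding C by (rule nowhere_dense_piece[OF S]) (use K close in auto)
  moreover have "full_group_orbit M R C = (\<Union>n. (\<lambda>T. full_group_act M R T C) ` K n)"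
    unfolding full_group_orbit_def K by (rule image_UN)
  ultimately show ?thesis
    unfolding meager_in_def by (intro exI[of _ "\<lambda>n. (\<lambda>T. full_group_act M R T C) ` K n"] conjI allI)
qed

end
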